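(* Let $m\geq n\geq \delta\geq 2$ be integers and let $k=n-\delta+1$. Let $\mathcal F=[\gamma_0,\gamma_1,\ldots,\gamma_{n-1}]$ be an $m\times n$ Ferrers diagram satisfying (1) $\gamma_{k}\geq n$, or $\gamma_{k}-k\geq \gamma_i-i$ for each $i=0,1,\ldots,k-1$; (2) $\gamma_{k+1}\geq n$ (this condition is void when $k+1=n$, i.e. when $\delta=2$). Then for any prime power $q$ there exists an optimal $[\mathcal F,\sum_{i=0}^{k-1}\gamma_i,\delta]_q$ code.
   Context: Ferrers diagrams. For positive integers $m,n$, an $m\times n$ Ferrers diagram is an $m\times n$ array of dots and empty cells such that all dots are shifted to the right, the number of dots in each row is at most the number of dots in the previous row, the first row has $n$ dots and the rightmost column has $m$ dots. It is identified with its column cardinalities: $\mathcal F=[\gamma_0,\gamma_1,\ldots,\gamma_{n-1}]$ with $1\leq\gamma_0\leq\gamma_1\leq\cdots\leq\gamma_{n-1}=m$, where the $(j+1)$-th column from the left has exactly $\gamma_j$ dots, located in its top $\gamma_j$ cells. Codes. For an $m\times n$ Ferrers diagram $\mathcal F$ and a prime power $q$, an $[\mathcal F,k,\delta]_q$ code (Ferrers diagram rank-metric code) is a $k$-dimensional $\mathbb F_q$-linear subspace of $\mathbb F_q^{m\times n}$ with minimum rank distance $\delta$ (the minimum of the ranks of its nonzero matrices), such that in every matrix of the code all entries at positions not in $\mathcal F$ are zero. Optimality. For $0\leq i\leq\delta-1$ let $v_i$ be the number of dots of $\mathcal F$ that are not contained in the first $i$ rows and are not contained in the rightmost $\delta-1-i$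 columns. Every $[\mathcal F,k,\delta]_q$ code satisfies $k\leq\min_{0\leq i\leq\delta-1}v_i$; the code is called optimal if equality holds. *)

theory Defs
  imports "Jordan_Normal_Form.DL_Rank" "HOL-Number_Theory.Prime_Powers"
begin

text \<open>
  A diagram is the set of its dots. The cell in row \<open>i\<close> and column \<open>j\<close> is \<open>(i, j)\<close>, with both
  indices starting from 0 (rows from the top, columns from the left), as in
  \<open>Jordan_Normal_Form.Matrix\<close>.
\<close>

definition row_dots :: "(nat \<times> nat) set \<Rightarrow> nat \<Rightarrow> nat" where
  "row_dots F i = card {j. (i, j) \<in> F}"

text \<open>\<open>col_dots F j\<close> is the column cardinality $\gamma_j$.\<close>

definition col_dots :: "(nat \<times> nat) set \<Rightarrow> nat \<Rightarrow> nat" where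
  "col_dots F j = card {i. (i, j) \<in> F}"

definition ferrers_diagram :: "nat \<Rightarrow> nat \<Rightarrow> (nat \<times> nat) set \<Rightarrow> bool" where
  "ferrers_diagram m n F \<longleftrightarrow>
     0 < m \<and> 0 < n \<and>
     F \<subseteq> {..<m} \<times> {..<n} \<and>
     (\<forall>i j j'. (i, j) \<in> F \<and> j \<le> j' \<and> j' < n \<longrightarrow> (i, j') \<in> F) \<and>
     (\<forall>i. Suc i < m \<longrightarrow> row_dots F (Suc i) \<le> row_dots F i) \<and>
     row_dots F 0 = n \<and>
     col_dots F (n - 1) = m"

text \<open>
  The least rank of a nonzero matrix in \<open>C\<close>, as a relation: it is undefined for a code without
  nonzero matrices. In \<open>vec_space.rank m\<close> the argument is the number of rows.
\<close>

definition has_min_rank_distance ::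
    "nat \<Rightarrow> nat \<Rightarrow> 'a::field mat set \<Rightarrow> nat \<Rightarrow> bool" where
  "has_min_rank_distance m n C \<delta> \<longleftrightarrow>
     (\<exists>A\<in>C. A \<noteq> 0\<^sub>m m n \<and> vec_space.rank m A = \<delta>) \<and>
     (\<forall>A\<in>C. A \<noteq> 0\<^sub>m m n \<longrightarrow> \<delta> \<le> vec_space.rank m A)"

text \<open>
  The predicate for $[\mathcal F, d, \delta]_q$ codes; the field with $q$ elements is the type
  \<open>'a\<close>.
\<close>

definition ferrers_code ::
    "nat \<Rightarrow> nat \<Rightarrow> (nat \<times> nat) set \<Rightarrow> nat \<Rightarrow> nat \<Rightarrow> 'a::{field,finite} mat set \<Rightarrow> bool" where
  "ferrers_code m n F d \<delta> C \<longleftrightarrow>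
     VectorSpace.subspace class_ring C (module_mat TYPE('a) m n) \<and>
     vectorspace.dim class_ring ((module_mat TYPE('a) m n)\<lparr>carrier := C\<rparr>) = d \<and>
     has_min_rank_distance m n C \<delta> \<and>
     (\<forall>A\<in>C. \<forall>i<m. \<forall>j<n. (i, j) \<notin> F \<longrightarrow> A $$ (i, j) = 0)"

text \<open>
  The number $v_i$ of dots outside the first \<open>i\<close> rows and the rightmost \<open>\<delta> - 1 - i\<close> columns. The
  column condition says \<open>c < n - (\<delta> - 1 - i)\<close>; for \<open>i < \<delta>\<close> the subtraction is exact.
\<close>

definition dots_outside :: "nat \<Rightarrow> (nat \<times> nat) set \<Rightarrow> nat \<Rightarrow> nat \<Rightarrow> nat" where
  "dots_outside n F \<delta> i = card {(r, c) \<in> F. i \<le> r \<and> c + (\<delta> - 1 - i) < n}"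

definition optimal_ferrers_code ::
    "nat \<Rightarrow> nat \<Rightarrow> (nat \<times> nat) set \<Rightarrow> nat \<Rightarrow> nat \<Rightarrow> 'a::{field,finite} mat set \<Rightarrow> bool" where
  "optimal_ferrers_code m n F d \<delta> C \<longleftrightarrow>
     ferrers_code m n F d \<delta> C \<and>
     d = Min (dots_outside n F \<delta> ` {0..\<delta> - 1})"

text \<open>The identification of a diagram with its sequence of column cardinalities.\<close>

lemma ferrers_diagram_iff_columns:
  assumes "0 < n"
  shows "ferrers_diagram m n F \<longleftrightarrow>
    (\<exists>\<gamma>. 1 \<le> \<gamma> 0 \<and> (\<forall>i j. i \<le> j \<and> j < n \<longrightarrow> \<gamma> i \<le> \<gamma> j) \<and> \<gamma> (n - 1) = m \<and>
         F = {(i, j). j < n \<and> i < \<gamma> j})"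
    (is "_ = ?R")
proof
  assume "ferrers_diagram m n F"
  hence sub: "F \<subseteq> {..<m} \<times> {..<n}" and m: "0 < m"
    and right: "\<And>i j j'. (i, j) \<in> F \<Longrightarrow> j \<le> j' \<Longrightarrow> j' < n \<Longrightarrow> (i, j') \<in> F"
    and rows: "\<And>i. Suc i < m \<Longrightarrow> row_dots F (Suc i) \<le> row_dots F i"
    and top: "row_dots F 0 = n" and last: "col_dots F (n - 1) = m"
    unfolding ferrers_diagram_def by blast+
  have fin: "finite {j. (i, j) \<in> F}" for i
    by (rule finite_subset[of _ "{..<n}"]) (use sub in auto)
  have finc: "finite {i. (i, j) \<in> F}" for j
    by (rule finite_subset[of _ "{..<m}"]) (use sub in auto)
  have up1: "(i, j) \<in> F" if *: "(Suc i, j) \<in> F" for i j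
  proof (rule ccontr)
    assume "(i, j) \<notin> F"
    have "Suc i < m" "j < n" using * sub by auto
    have "{j'. (i, j') \<in> F} \<subset> {j'. (Suc i, j') \<in> F}"
    proof
      show "{j'. (i, j') \<in> F} \<subseteq> {j'. (Suc i, j') \<in> F}"
      proof clarify
        fix j' assume "(i, j') \<in> F"
        hence "j < j'" using right[of i j' j] \<open>(i, j) \<notin> F\<close> \<open>j < n\<close> by (meson not_le)
        moreover have "j' < n" using \<open>(i, j') \<in> F\<close> sub by auto
        ultimately show "(Suc i, j') \<in> F" using right[OF *, of j'] by simp
      qed
      show "{j'. (i, j') \<in> F} \<noteq> {j'. (Suc i, j') \<in> F}" using * \<open>(i, j) \<notin> F\<close> by blast
    qed
    hence "row_dots F i < row_dots F (Suc i)"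
      unfolding row_dots_def by (rule psubset_card_mono[OF fin])
    with rows[OF \<open>Suc i < m\<close>] show False by simp
  qed
  have up: "(i', j) \<in> F" if "(i, j) \<in> F" "i' \<le> i" for i i' j
    using that(2,1) by (induction rule: inc_induct) (assumption, rule up1)
  have col: "{i. (i, j) \<in> F} = {..<col_dots F j}" for j
  proof -
    let ?S = "{i. (i, j) \<in> F}"
    have "?S = {..<LEAST i. i \<notin> ?S}"
    proof -
      have ex: "\<exists>i. i \<notin> ?S" using finc ex_new_if_finite infinite_UNIV_nat by blast
      define l where "l = (LEAST i. i \<notin> ?S)"
      have "l \<notin> ?S" unfolding l_def by (rule LeastI_ex[OF ex])
      hence "i < l" if "i \<in> ?S" for i using up[of i j l] that by (cases "i < l") auto
      moreover have "i \<in> ?S" if "i < l" for i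
        using not_less_Least[of i "\<lambda>i. i \<notin> ?S"] that unfolding l_def by simp
      ultimately show ?thesis unfolding l_def[symmetric] by blast
    qed
    thus ?thesis unfolding col_dots_def by (metis card_lessThan)
  qed
  have F: "F = {(i, j). j < n \<and> i < col_dots F j}"
    using col sub by (auto simp: set_eq_iff)
  have "{j. (0, j) \<in> F} = {..<n}"
    by (rule card_subset_eq) (use top sub in \<open>auto simp: row_dots_def\<close>)
  hence "(0, 0) \<in> F" using assms by auto
  hence "1 \<le> col_dots F 0" using col[of 0] by (auto simp: set_eq_iff Suc_le_eq)
  moreover have "col_dots F i \<le> col_dots F j" if "i \<le> j" "j < n" for i j
    unfolding col_dots_def by (rule card_mono[OF finc]) (use right that in blast)
  ultimately show ?R using last F by blast
next
  assume ?R
  then obtain \<gamma> where g0: "1 \<le> \<gamma> 0" and mono: "\<And>i j. i \<le> j \<Longrightarrow> j < n \<Longrightarrow> \<gamma> i \<le> \<gamma> j"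
    and last: "\<gamma> (n - 1) = m" and F: "F = {(i, j). j < n \<and> i < \<gamma> j}" by blast
  have le: "\<gamma> j \<le> m" if "j < n" for j using mono[of j "n - 1"] that last by simp
  have pos: "0 < \<gamma> j" if "j < n" for j using mono[of 0 j] that g0 by simp
  have "row_dots F (Suc i) \<le> row_dots F i" for i
    unfolding row_dots_def F by (rule card_mono) auto
  moreover have "{j. (0, j) \<in> F} = {..<n}" using pos F by auto
  hence "row_dots F 0 = n" by (simp add: row_dots_def)
  moreover have "{i. (i, n - 1) \<in> F} = {..<m}" using F last assms by auto
  hence "col_dots F (n - 1) = m" by (simp add: col_dots_def)
  moreover have "F \<subseteq> {..<m} \<times> {..<n}" using F le by fastforce
  moreover have "0 < m" using pos[of "n - 1"] last assms by simp
  moreover have "(i, j') \<in> F" if "(i, j) \<in> F" "j \<le> j'" "j' < n" for i j j'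
    using that F mono[of j j'] by auto
  ultimately show "ferrers_diagram m n F"
    unfolding ferrers_diagram_def using assms by (intro conjI allI impI) (simp_all, blast?)
qed

end

theory Submission
  imports Defs "HOL-Algebra.Algebraic_Closure_Type" "HOL-Number_Theory.Residues"
begin

text \<open>
  Let $N = \max(n, \gamma_{k-1})$ and use only the first $N$ rows. Columns are read as elements of
  $K = \mathbf F_{q^N}$ in a basis $1, b, \ldots, b^{N-1}$. As for Gabidulin codes, the columns of a
  codeword are the values $f(g_0), \ldots, f(g_{n-1})$ of a linearized polynomial $f$ of
  $q$-degree less than $k$ at points $g_j$ that are linearly independent over $\mathbf F_q$; a nonzero
  $f$ has at most $q^{k-1}$ roots, so every nonzero codeword has rank at least $n-k+1 = \delta$.
  The first $k$ columns can be prescribed freely, and columns $k+1, \ldots, n-1$ have full height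
  $N$, so only column $k$ is critical when $\gamma_k < n$. The points are chosen such that
  $f(g_k) = -\sum_{i<k} b^{k-i} f(g_i)$ for all $f$; since multiplication by $b^{k-i}$ moves the first
  $\gamma_i$ coordinates into the first $\gamma_i + k - i \le \gamma_k$ coordinates, column $k$ fits.
  All dimensions are found by counting elements.
\<close>

section \<open>Dimension and rank by counting\<close>

lemma finite_field_power_card:
  fixes x :: "'a::{field,finite}"
  shows "x ^ card (UNIV :: 'a set) = x"
proof (cases "x = 0")
  case True
  then show ?thesis by (simp add: card_gt_0_iff)
next
  case False
  let ?U = "UNIV - {0 :: 'a}"
  have "bij_betw ((*) x) ?U ?U"
    by (rule bij_betw_byWitness[where f' = "\<lambda>y. y / x"]) (use False in auto)
  then have "(\<Prod>y\<in>?U. y) = (\<Prod>y\<in>?U. x * y)"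
    by (rule prod.reindex_bij_betw[symmetric])
  also have "\<dots> = x ^ card ?U * (\<Prod>y\<in>?U. y)"
    by (simp only: prod.distrib prod_constant)
  finally have "x ^ card ?U = 1"
    using prod_zero_iff[of ?U "\<lambda>y. y"] by (metis Diff_iff finite mult_cancel_right1 singletonI)
  then have "x ^ Suc (card ?U) = x" by simp
  moreover have "Suc (card ?U) = card (UNIV :: 'a set)"
    by (metis UNIV_I card.remove finite_class.finite_UNIV)
  ultimately show ?thesis by simp
qed

text \<open>Coordinates in a basis identify vectors with functions from the basis to the scalars.
  Ranks and dimensions below are read off from cardinalities in this way.\<close>

lemma (in vectorspace) card_carrier_eq_power_dim:
  assumes "finite (carrier V)"
  shows "card (carrier V) = card (carrier K) ^ dim"
proof -
  have fd: fin_dim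
    unfolding fin_dim_def using assms
    using span_is_subset2[of "carrier V"] in_own_span[of "carrier V"]
    by (intro exI[of _ "carrier V"]) auto
  then obtain B where B: "finite B" "basis B" using finite_basis_exists by blast
  then have BV: "B \<subseteq> carrier V" by (simp add: basis_def)
  have ex: "\<exists>!a. a \<in> B \<rightarrow>\<^sub>E carrier K \<and> lincomb a B = v" if "v \<in> carrier V" for v
    using basis_criterion[OF B(1) BV] B(2) that by blast
  have closed: "lincomb a B \<in> carrier V" if "a \<in> B \<rightarrow>\<^sub>E carrier K" for a
    using BV that by (intro lincomb_closed) auto
  have "bij_betw (\<lambda>a. lincomb a B) (B \<rightarrow>\<^sub>E carrier K) (carrier V)"
    unfolding bij_betw_def
  proof
    show "inj_on (\<lambda>a. lincomb a B) (B \<rightarrow>\<^sub>E carrier K)"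
      by (rule inj_onI) (metis ex closed)
    show "(\<lambda>a. lincomb a B) ` (B \<rightarrow>\<^sub>E carrier K) = carrier V"
    proof
      show "carrier V \<subseteq> (\<lambda>a. lincomb a B) ` (B \<rightarrow>\<^sub>E carrier K)"
        using ex by (force simp: image_iff)
    qed (use closed in auto)
  qed
  then have "card (carrier V) = card (B \<rightarrow>\<^sub>E carrier K)" by (simp add: bij_betw_same_card)
  also have "\<dots> = card (carrier K) ^ dim"
    using B by (simp add: card_PiE dim_basis)
  finally show ?thesis .
qed

lemma carrier_vec_eq_image: "carrier_vec n = vec n ` ({..<n} \<rightarrow>\<^sub>E UNIV)"
proof (intro equalityI subsetI)
  fix x :: "'a vec" assume "x \<in> carrier_vec n"
  then have "x = vec n (restrict (\<lambda>j. x $ j) {..<n})" by (intro eq_vecI) auto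
  then show "x \<in> vec n ` ({..<n} \<rightarrow>\<^sub>E UNIV)"
    by (rule image_eqI[where x = "restrict (\<lambda>j. x $ j) {..<n}"]) auto
next
  fix x :: "'a vec" assume "x \<in> vec n ` ({..<n} \<rightarrow>\<^sub>E UNIV)"
  then show "x \<in> carrier_vec n" by (elim imageE) simp
qed

lemma finite_carrier_vec: "finite (carrier_vec n :: 'a::finite vec set)"
  unfolding carrier_vec_eq_image by (simp add: finite_PiE)

text \<open>The products \<open>A *\<^sub>v x\<close> form the column space, whose dimension is the
  rank.\<close>

lemma card_col_space:
  fixes A :: "'a::{field,finite} mat"
  assumes A: "A \<in> carrier_mat m n"
  shows "card ((\<lambda>x. A *\<^sub>v x) ` carrier_vec n) = card (UNIV :: 'a set) ^ vec_space.rank m A"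
proof -
  interpret vec_space "TYPE('a)" m .
  have cols: "set (cols A) \<subseteq> carrier_vec m" using A cols_dim by blast
  have eq: "span (set (cols A)) = (\<lambda>x. A *\<^sub>v x) ` carrier_vec n"
    using col_space_eq[OF A] A unfolding col_space_def by auto
  interpret S: vectorspace class_ring "V\<lparr>carrier := span (set (cols A))\<rparr>"
    by (rule subspace_is_vs[OF span_is_subspace[OF cols]])
  have "finite (span (set (cols A)))"
    unfolding eq using finite_carrier_vec by blast
  then have "card (span (set (cols A))) = card (UNIV :: 'a set) ^ S.dim"
    using S.card_carrier_eq_power_dim by (simp add: class_ring_simps)
  then show ?thesis by (simp add: eq rank_def)
qed

text \<open>The product with \<open>x\<close> depends only on the last \<open>n - l\<close>
  coordinates of \<open>x\<close>, which bounds the number of products. This serves to show that the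
  minimum distance is attained.\<close>

lemma vec_space_rank_le:
  fixes A :: "'a::{field,finite} mat"
  assumes A: "A \<in> carrier_mat m n" and zero: "\<And>i j. i < m \<Longrightarrow> j < n \<Longrightarrow> j < l \<Longrightarrow> A $$ (i, j) = 0"
  shows "vec_space.rank m A \<le> n - l"
proof -
  let ?S = "{l..<n} \<rightarrow>\<^sub>E (UNIV :: 'a set)"
  have "(\<lambda>x. A *\<^sub>v x) ` carrier_vec n \<subseteq> (\<lambda>f. A *\<^sub>v vec n f) ` ?S"
  proof (rule image_subsetI)
    fix x :: "'a vec" assume x: "x \<in> carrier_vec n"
    have "A *\<^sub>v x = A *\<^sub>v vec n (restrict (\<lambda>j. x $ j) {l..<n})"
      using A x zero by (intro eq_vecI) (auto simp: scalar_prod_def intro!: sum.cong)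
    then show "A *\<^sub>v x \<in> (\<lambda>f. A *\<^sub>v vec n f) ` ?S"
      by (rule image_eqI[where x = "restrict (\<lambda>j. x $ j) {l..<n}"]) auto
  qed
  then have "card ((\<lambda>x. A *\<^sub>v x) ` carrier_vec n) \<le> card ((\<lambda>f. A *\<^sub>v vec n f) ` ?S)"
    by (intro card_mono) (simp_all add: finite_PiE)
  also have "\<dots> \<le> card ?S" by (rule card_image_le) (simp add: finite_PiE)
  also have "\<dots> = card (UNIV :: 'a set) ^ (n - l)" by (simp add: card_PiE)
  finally have "card (UNIV :: 'a set) ^ vec_space.rank m A \<le> card (UNIV :: 'a set) ^ (n - l)"
    by (simp add: card_col_space[OF A])
  moreover have "1 < card (UNIV :: 'a set)"
    using card_mono[of "UNIV :: 'a set" "{0, 1}"] by simp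
  ultimately show ?thesis by simp
qed

section \<open>The field with $q^N$ elements inside the algebraic closure\<close>

locale finite_base_field =
  fixes ty :: "'a::{field,finite} itself" and q :: nat
  assumes primepow_q: "primepow q" and card_UNIV: "card (UNIV :: 'a set) = q"
begin

lemma q_gt_1: "1 < q"
  using primepow_q primepow_gt_Suc_0 by auto

lemma prime_CHAR: "Factorial_Ring.prime CHAR('a)"
  using CHAR_dvd_CARD[where 'a = 'a] prime_CHAR_semidom[where 'a = 'a]
  by (metis card_gt_0_iff dvd_0_left_iff finite gr0I neq0_conv UNIV_not_empty)

text \<open>Makes raising to the power \<open>q ^ s\<close> an iterate of the Frobenius map, which
  is additive on the closure.\<close>

lemma q_eq_CHAR_power: "\<exists>e. q = CHAR('a alg_closure) ^ e"
proof -
  obtain p e where pe: "Factorial_Ring.prime p" "q = p ^ e"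
    using primepow_q by (auto simp: primepow_def)
  have "CHAR('a) = p"
    using prime_CHAR CHAR_dvd_CARD[where 'a = 'a] pe card_UNIV
    by (metis prime_dvd_power primes_dvd_imp_eq)
  then show ?thesis using pe by auto
qed

lemma power_q_sum: "(\<Sum>i\<in>A. f i :: 'a alg_closure) ^ (q ^ s) = (\<Sum>i\<in>A. f i ^ (q ^ s))"
proof -
  obtain e where "q = CHAR('a alg_closure) ^ e" using q_eq_CHAR_power by blast
  then have "q ^ s = CHAR('a alg_closure) ^ (e * s)" by (simp add: power_mult)
  then show ?thesis using prime_CHAR by (intro freshmans_dream_sum') auto
qed

lemma power_q_diff: "(x - y :: 'a alg_closure) ^ (q ^ s) = x ^ (q ^ s) - y ^ (q ^ s)"
proof -
  obtain e where "q = CHAR('a alg_closure) ^ e" using q_eq_CHAR_power by blast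
  then have "q ^ s = CHAR('a alg_closure) ^ (e * s)" by (simp add: power_mult)
  then have "((x - y) + y) ^ (q ^ s) = (x - y) ^ (q ^ s) + y ^ (q ^ s)"
    using prime_CHAR by (intro freshmans_dream') auto
  then show ?thesis by simp
qed

lemma power_q_eq_iff: "(x :: 'a alg_closure) ^ (q ^ s) = y ^ (q ^ s) \<longleftrightarrow> x = y"
  using power_q_diff[of x y s] by (metis eq_iff_diff_eq_0 power_eq_0_iff)

lemma power_q_to_ac: "to_ac (a :: 'a) ^ (q ^ s) = to_ac a"
proof -
  have "a ^ (q ^ s) = a"
    using finite_field_power_card[of a] by (induction s) (simp_all add: power_mult card_UNIV)
  then show ?thesis by (metis to_ac_power)
qed

text \<open>The image of \<open>to_ac\<close> is the base field, and \<open>ext_field N\<close> is its extension of degree \<open>N\<close>.\<close>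

definition ext_field :: "nat \<Rightarrow> 'a alg_closure set" where
  "ext_field N = {x. x ^ (q ^ N) = x}"

text \<open>The polynomial X^(q^N) - X splits over the closure and has derivative -1, so its roots
  are simple and their number is its degree.\<close>

lemma card_ext_field:
  assumes "0 < N"
  shows "finite (ext_field N)" "card (ext_field N) = q ^ N"
proof -
  define p :: "'a alg_closure poly" where "p = Polynomial.monom 1 (q ^ N) - Polynomial.monom 1 1"
  have N1: "1 < q ^ N" using q_gt_1 assms by (rule one_less_power)
  have deg: "Polynomial.degree p = q ^ N"
    unfolding p_def diff_conv_add_uminus using N1
    by (subst degree_add_eq_left) (simp_all add: degree_monom_eq)
  with N1 have p0: "p \<noteq> 0" by (metis degree_0 not_less_zero)
  have L_eq: "ext_field N = {x. poly p x = 0}" by (auto simp: ext_field_def p_def poly_monom)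
  show "finite (ext_field N)" using poly_roots_finite[OF p0] by (simp add: L_eq)
  have "of_nat (q ^ N) = (0 :: 'a alg_closure)"
    using CHAR_dvd_CARD[where 'a = 'a] assms card_UNIV
    by (metis CHAR_alg_closure dvd_power dvd_trans of_nat_eq_0_iff_char_dvd)
  then have "pderiv p = Polynomial.monom 0 (q ^ N - 1) - Polynomial.monom 1 0"
    unfolding p_def pderiv_diff pderiv_monom by simp
  then have "pderiv p = - Polynomial.monom 1 0" by simp
  then have p': "poly (pderiv p) x \<noteq> 0" for x by (simp add: poly_monom)
  have ord: "Polynomial.order x p = 1" if "poly p x = 0" for x
  proof -
    have "\<not> [:-x, 1:] ^ 2 dvd p"
    proof
      assume "[:-x, 1:] ^ 2 dvd p"
      then obtain r where "p = [:-x, 1:] * ([:-x, 1:] * r)"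
        by (metis dvdE mult.assoc power2_eq_square)
      then have "poly (pderiv p) x = 0" by (simp only: pderiv_mult) simp
      then show False using p' by blast
    qed
    then have "\<not> 2 \<le> Polynomial.order x p" using p0 by (simp add: order_divides)
    moreover have "Polynomial.order x p \<noteq> 0" using p0 that by (simp add: order_root)
    ultimately show ?thesis by linarith
  qed
  obtain A where A: "size A = Polynomial.degree p"
      "p = Polynomial.smult (Polynomial.lead_coeff p) (\<Prod>x\<in>#A. [:-x, 1:])"
    using alg_closed_imp_factorization[OF p0] by blast
  \<comment> \<open>The splitting into linear factors shows that the multiplicities of the roots add
    up to the degree.\<close>
  have "proots (\<Prod>x\<in>#A. [:-x, 1:]) = A"
    using proots_prod_mset[of "image_mset (\<lambda>x. [:-x, 1:]) A"]
    by (simp add: image_mset.compositionality comp_def image_iff)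
  then have "proots p = A"
    by (subst A(2)) (use p0 in simp)
  then have "q ^ N = (\<Sum>x\<in>set_mset (proots p). count (proots p) x)"
    using A(1) by (simp add: deg size_multiset_overloaded_eq)
  also have "\<dots> = (\<Sum>x\<in>ext_field N. Polynomial.order x p)"
    using p0 by (simp add: L_eq)
  also have "\<dots> = card (ext_field N)" using ord by (simp add: L_eq)
  finally show "card (ext_field N) = q ^ N" ..
qed

lemma ext_field_0 [simp]: "0 \<in> ext_field N"
  using q_gt_1 by (simp add: ext_field_def)

lemma ext_field_to_ac [simp]: "to_ac a \<in> ext_field N"
  by (simp add: ext_field_def power_q_to_ac)

lemma ext_field_1 [simp]: "1 \<in> ext_field N"
  using ext_field_to_ac[of 1] by simp

lemma ext_field_mult: "x \<in> ext_field N \<Longrightarrow> y \<in> ext_field N \<Longrightarrow> x * y \<in> ext_field N"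
  by (simp add: ext_field_def power_mult_distrib)

lemma ext_field_diff: "x \<in> ext_field N \<Longrightarrow> y \<in> ext_field N \<Longrightarrow> x - y \<in> ext_field N"
  by (simp add: ext_field_def power_q_diff)

lemma ext_field_uminus: "x \<in> ext_field N \<Longrightarrow> - x \<in> ext_field N"
  using ext_field_diff[of 0 N x] by simp

lemma ext_field_power: "x \<in> ext_field N \<Longrightarrow> x ^ i \<in> ext_field N"
  by (induction i) (auto intro: ext_field_mult)

lemma ext_field_sum: "(\<And>i. i \<in> A \<Longrightarrow> f i \<in> ext_field N) \<Longrightarrow> sum f A \<in> ext_field N"
  by (simp add: ext_field_def power_q_sum)

section \<open>Linearized polynomials\<close>

definition lpoly :: "nat \<Rightarrow> (nat \<Rightarrow> 'a alg_closure) \<Rightarrow> 'a alg_closure \<Rightarrow> 'a alg_closure" where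
  "lpoly K a x = (\<Sum>s<K. a s * x ^ (q ^ s))"

text \<open>Frobenius powers are additive and fix the image of \<open>to_ac\<close>, so evaluation
  is linear over the base field.\<close>

lemma lpoly_comb:
  "lpoly K a (\<Sum>j\<in>J. to_ac (v j) * x j) = (\<Sum>j\<in>J. to_ac (v j) * lpoly K a (x j))"
proof -
  have "lpoly K a (\<Sum>j\<in>J. to_ac (v j) * x j) = (\<Sum>s<K. \<Sum>j\<in>J. to_ac (v j) * (a s * x j ^ (q ^ s)))"
    by (simp add: lpoly_def power_q_sum power_mult_distrib power_q_to_ac sum_distrib_left mult_ac)
  also have "\<dots> = (\<Sum>j\<in>J. to_ac (v j) * lpoly K a (x j))"
    by (subst sum.swap) (simp add: lpoly_def sum_distrib_left)
  finally show ?thesis .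
qed

lemma lpoly_diff: "lpoly K (\<lambda>s. a s - b s) x = lpoly K a x - lpoly K b x"
  by (simp add: lpoly_def left_diff_distrib sum_subtractf)

lemma lpoly_coeff_zero: "(\<And>s. s < K \<Longrightarrow> a s = 0) \<Longrightarrow> lpoly K a x = 0"
  by (simp add: lpoly_def)

lemma lpoly_cong: "(\<And>s. s < K \<Longrightarrow> a s = b s) \<Longrightarrow> lpoly K a x = lpoly K b x"
  by (simp add: lpoly_def)

lemma lpoly_mem_ext_field:
  assumes "\<And>s. s < K \<Longrightarrow> a s \<in> ext_field N" "x \<in> ext_field N"
  shows "lpoly K a x \<in> ext_field N"
  unfolding lpoly_def using assms by (intro ext_field_sum ext_field_mult ext_field_power) auto

text \<open>A nonzero polynomial of degree at most q^(K-1) has at most that many roots. All fibres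
  are bounded, not only the kernel, because \<open>rank_code_ge\<close> counts values fibre by
  fibre.\<close>

lemma lpoly_fibre:
  assumes "s0 < K" "a s0 \<noteq> 0"
  shows "finite {x. lpoly K a x = y}" "card {x. lpoly K a x = y} \<le> q ^ (K - 1)"
proof -
  define p where "p = (\<Sum>s<K. Polynomial.monom (a s) (q ^ s)) - [:y:]"
  have eq: "poly p x = 0 \<longleftrightarrow> lpoly K a x = y" for x
    by (simp add: p_def lpoly_def poly_sum poly_monom)
  \<comment> \<open>The exponents \<open>q ^ s\<close> are distinct and positive, so neither another
    term nor the constant \<open>y\<close> contributes to this coefficient.\<close>
  have "poly.coeff p (q ^ s0) = (\<Sum>s<K. if s = s0 then a s else 0)"
    unfolding p_def coeff_diff coeff_sum
    using q_gt_1 by (auto simp: coeff_pCons split: nat.split intro!: sum.cong)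
  then have p0: "p \<noteq> 0" using assms by auto
  have "Polynomial.degree (\<Sum>s<K. Polynomial.monom (a s) (q ^ s)) \<le> q ^ (K - 1)"
  proof (rule degree_sum_le)
    fix s assume "s \<in> {..<K}"
    then have "q ^ s \<le> q ^ (K - 1)" using q_gt_1 by (intro power_increasing) auto
    then show "Polynomial.degree (Polynomial.monom (a s) (q ^ s)) \<le> q ^ (K - 1)"
      using degree_monom_le[of "a s" "q ^ s"] by simp
  qed simp
  then have "Polynomial.degree p \<le> q ^ (K - 1)"
    unfolding p_def by (intro degree_diff_le) auto
  then show "card {x. lpoly K a x = y} \<le> q ^ (K - 1)"
    using card_poly_roots_bound[OF p0] by (simp add: eq)
  show "finite {x. lpoly K a x = y}"
    using poly_roots_finite[OF p0] by (simp add: eq)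
qed

section \<open>Linear independence over the base field and interpolation\<close>

definition indep :: "(nat \<Rightarrow> 'a alg_closure) \<Rightarrow> nat \<Rightarrow> bool" where
  "indep g n \<longleftrightarrow> (\<forall>v :: nat \<Rightarrow> 'a. (\<Sum>j<n. to_ac (v j) * g j) = 0 \<longrightarrow> (\<forall>j<n. v j = 0))"

lemma indepD:
  fixes v :: "nat \<Rightarrow> 'a"
  assumes "indep g n" "(\<Sum>j<n. to_ac (v j) * g j) = (\<Sum>j<n. to_ac (w j) * g j)" "j < n"
  shows "v j = w j"
proof -
  have "(\<Sum>j<n. to_ac (v j - w j) * g j) = 0"
    using assms(2) by (simp add: left_diff_distrib sum_subtractf)
  then have "v j - w j = 0"
    using assms(1)[unfolded indep_def, rule_format, of "\<lambda>j. v j - w j" j] assms(3) by blast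
  then show ?thesis by simp
qed

lemma indep_inj_on:
  assumes "indep g n"
  shows "inj_on (\<lambda>v. \<Sum>j<n. to_ac (v j) * g j) ({..<n} \<rightarrow>\<^sub>E (UNIV :: 'a set))"
proof (rule inj_onI)
  fix v w :: "nat \<Rightarrow> 'a"
  assume vw: "v \<in> {..<n} \<rightarrow>\<^sub>E UNIV" "w \<in> {..<n} \<rightarrow>\<^sub>E UNIV"
    and "(\<Sum>j<n. to_ac (v j) * g j) = (\<Sum>j<n. to_ac (w j) * g j)"
  then have "v j = w j" if "j < n" for j using indepD[OF assms, of v w j] that by blast
  then show "v = w" by (intro PiE_ext[OF vw]) simp
qed

lemma card_funs: "card ({..<n} \<rightarrow>\<^sub>E (UNIV :: 'a set)) = q ^ n"
  by (simp add: card_PiE card_UNIV)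

text \<open>All q^K combinations of the points are roots, more than the q^(K-1) that a nonzero
  coefficient would allow.\<close>

lemma lpoly_zero_on_indep:
  assumes "indep g K" "\<And>i. i < K \<Longrightarrow> lpoly K a (g i) = 0" "s < K"
  shows "a s = 0"
proof (rule ccontr)
  assume "a s \<noteq> 0"
  note roots = lpoly_fibre[where a = a and y = 0, OF assms(3) this]
  have "(\<lambda>v. \<Sum>j<K. to_ac (v j) * g j) ` ({..<K} \<rightarrow>\<^sub>E (UNIV :: 'a set)) \<subseteq> {x. lpoly K a x = 0}"
    using assms(2) by (auto simp: lpoly_comb)
  from card_mono[OF roots(1) this] have "q ^ K \<le> q ^ (K - 1)"
    using roots(2) by (simp add: card_image[OF indep_inj_on[OF assms(1)]] card_funs)
  moreover have "q ^ (K - 1) < q ^ K"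
    using assms(3) q_gt_1 by (intro power_strict_increasing) auto
  ultimately show False by simp
qed

text \<open>Evaluation at the points maps a finite set of tuples into itself; a trivial kernel makes
  it injective, hence surjective. The kernel condition is a hypothesis because it is verified in two
  ways: from independence in \<open>code_exists\<close>, and from a triangular system in
  \<open>special_points\<close>, where independence is still to be shown.\<close>

lemma lpoly_interpolation:
  assumes "0 < N" "\<And>i. i < K \<Longrightarrow> g i \<in> ext_field N"
    and ker: "\<And>a s. (\<And>i. i < K \<Longrightarrow> lpoly K a (g i) = 0) \<Longrightarrow> s < K \<Longrightarrow> a s = 0"
    and c: "\<And>i. i < K \<Longrightarrow> c i \<in> ext_field N"
  shows "\<exists>a. (\<forall>s<K. a s \<in> ext_field N) \<and> (\<forall>i<K. lpoly K a (g i) = c i)"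
proof -
  let ?S = "{..<K} \<rightarrow>\<^sub>E ext_field N"
  let ?T = "\<lambda>a. restrict (\<lambda>i. lpoly K a (g i)) {..<K}"
  have "finite ?S" using card_ext_field[OF assms(1)] by (simp add: finite_PiE)
  moreover have "?T ` ?S \<subseteq> ?S"
    using assms(2) by (auto intro!: lpoly_mem_ext_field)
  moreover have "inj_on ?T ?S"
  proof (rule inj_onI)
    fix a b assume ab: "a \<in> ?S" "b \<in> ?S" "?T a = ?T b"
    have "lpoly K (\<lambda>s. a s - b s) (g i) = 0" if "i < K" for i
      using fun_cong[OF ab(3), of i] that by (simp add: lpoly_diff)
    then have "a s - b s = 0" if "s < K" for s
      using ker[of "\<lambda>s. a s - b s"] that by blast
    then show "a = b" using ab(1,2) by (intro PiE_ext) auto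
  qed
  ultimately have surj: "?T ` ?S = ?S" by (rule endo_inj_surj)
  have "restrict c {..<K} \<in> ?T ` ?S" unfolding surj using c by auto
  then obtain a where a: "a \<in> ?S" "restrict c {..<K} = ?T a" by blast
  have "lpoly K a (g i) = c i" if "i < K" for i
    using fun_cong[OF a(2), of i] that by simp
  then show ?thesis using a(1) by (intro exI[of _ a]) auto
qed

text \<open>The q^N combinations are distinct elements of a set with q^N elements.\<close>

lemma indep_spans:
  assumes "0 < N" "indep g N" "\<And>i. i < N \<Longrightarrow> g i \<in> ext_field N" "x \<in> ext_field N"
  shows "\<exists>v :: nat \<Rightarrow> 'a. x = (\<Sum>j<N. to_ac (v j) * g j)"
proof -
  let ?T = "\<lambda>v. \<Sum>j<N. to_ac (v j) * g j"
  have "?T ` ({..<N} \<rightarrow>\<^sub>E (UNIV :: 'a set)) = ext_field N"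
  proof (rule card_subset_eq)
    show "?T ` ({..<N} \<rightarrow>\<^sub>E (UNIV :: 'a set)) \<subseteq> ext_field N"
      using assms(3) by (auto intro!: ext_field_sum ext_field_mult)
  qed (use card_ext_field[OF assms(1)] in \<open>simp_all add: card_image[OF indep_inj_on[OF assms(2)]] card_funs\<close>)
  then have "x \<in> ?T ` ({..<N} \<rightarrow>\<^sub>E (UNIV :: 'a set))" using assms(4) by simp
  then show ?thesis by blast
qed

text \<open>At most q^j combinations of the first \<open>j\<close> points cannot fill a set of q^N
  elements; any element that they miss will do.\<close>

lemma indep_extend_one:
  assumes "indep g j" "j < N"
  shows "\<exists>x\<in>ext_field N. indep (g(j := x)) (Suc j)"
proof -
  let ?T = "\<lambda>v. \<Sum>i<j. to_ac (v i) * g i"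
  let ?S = "{..<j} \<rightarrow>\<^sub>E (UNIV :: 'a set)"
  have fin: "finite ?S" by (simp add: finite_PiE)
  have "card (?T ` ?S) \<le> q ^ j"
    using card_image_le[OF fin, of ?T] by (simp add: card_funs)
  also have "\<dots> < card (ext_field N)"
    using card_ext_field(2)[of N] assms(2) q_gt_1 by (simp add: power_strict_increasing)
  finally have "\<not> ext_field N \<subseteq> ?T ` ?S"
    using card_mono[OF finite_imageI[OF fin], of "ext_field N" ?T] by linarith
  then obtain x where x: "x \<in> ext_field N" "x \<notin> ?T ` ?S" by blast
  have "indep (g(j := x)) (Suc j)"
    unfolding indep_def
  proof (intro allI impI)
    fix v :: "nat \<Rightarrow> 'a" and i
    assume *: "(\<Sum>i<Suc j. to_ac (v i) * (g(j := x)) i) = 0" and i: "i < Suc j"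
    then have eq: "?T v + to_ac (v j) * x = 0" by simp
    have vj: "v j = 0"
    proof (rule ccontr)
      assume "v j \<noteq> 0"
      have "to_ac (v j) * x = - (?T v)" using eq by (simp add: eq_neg_iff_add_eq_0 add.commute)
      then have "x = - (?T v) / to_ac (v j)"
        using \<open>v j \<noteq> 0\<close> by (metis nonzero_mult_div_cancel_left to_ac_eq_0_iff)
      also have "\<dots> = ?T (restrict (\<lambda>i. - v i / v j) {..<j})"
        by (simp add: sum_divide_distrib sum_negf)
      finally have "x \<in> ?T ` ?S" by (rule image_eqI[where f = ?T]) (simp only: restrict_PiE_iff, simp)
      then show False using x(2) by contradiction
    qed
    then have "?T v = 0" using eq by simp
    then have "\<forall>i<j. v i = 0" using assms(1) by (simp add: indep_def)
    then show "v i = 0" using vj i by (auto simp: less_Suc_eq)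
  qed
  then show ?thesis using x(1) by blast
qed

lemma indep_extend:
  assumes "j \<le> n" "n \<le> N" "indep g j" "\<And>i. i < j \<Longrightarrow> g i \<in> ext_field N"
  shows "\<exists>h. indep h n \<and> (\<forall>i<n. h i \<in> ext_field N) \<and> (\<forall>i<j. h i = g i)"
  using assms(1,2)
proof (induction n rule: dec_induct)
  case base
  then show ?case using assms by blast
next
  case (step n)
  then obtain h where h: "indep h n" "\<forall>i<n. h i \<in> ext_field N" "\<forall>i<j. h i = g i" by auto
  obtain x where x: "x \<in> ext_field N" "indep (h(n := x)) (Suc n)"
    using indep_extend_one[OF h(1), of N] step.prems by auto
  have "\<forall>i<Suc n. (h(n := x)) i \<in> ext_field N" "\<forall>i<j. (h(n := x)) i = g i"
    using h x(1) step.hyps by auto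
  then show ?case using x(2) by blast
qed

section \<open>Elements with N distinct conjugates and their power bases\<close>

definition generator :: "nat \<Rightarrow> 'a alg_closure \<Rightarrow> bool" where
  "generator N b \<longleftrightarrow> b \<in> ext_field N \<and> (\<forall>j. 0 < j \<and> j < N \<longrightarrow> b ^ (q ^ j) \<noteq> b)"

lemma sum_powers_less: "(\<Sum>j<n. q ^ j) < q ^ n"
proof (induction n)
  case (Suc n)
  have "(\<Sum>j<Suc n. q ^ j) < 2 * q ^ n" using Suc by simp
  also have "\<dots> \<le> q ^ Suc n" using q_gt_1 by simp
  finally show ?case .
qed simp

text \<open>The sets \<open>ext_field j\<close> with \<open>0 < j < N\<close> together have at most
  q + ... + q^(N-1) elements, which is less than q^N.\<close>

lemma generator_exists:
  assumes "0 < N"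
  shows "\<exists>b. generator N b"
proof -
  have "card (\<Union>j\<in>{1..<N}. ext_field j) \<le> (\<Sum>j\<in>{1..<N}. card (ext_field j))"
    by (rule card_UN_le) simp
  also have "\<dots> = (\<Sum>j\<in>{1..<N}. q ^ j)"
    by (rule sum.cong) (auto simp: card_ext_field)
  also have "\<dots> \<le> (\<Sum>j<N. q ^ j)"
    by (rule sum_mono2) auto
  also have "\<dots> < card (ext_field N)"
    using sum_powers_less by (simp add: card_ext_field assms)
  finally have less: "card (\<Union>j\<in>{1..<N}. ext_field j) < card (ext_field N)" .
  have "finite (\<Union>j\<in>{1..<N}. ext_field j)" using card_ext_field(1) by auto
  then have "\<not> ext_field N \<subseteq> (\<Union>j\<in>{1..<N}. ext_field j)" using card_mono less by (meson not_le)
  then obtain b where b: "b \<in> ext_field N" "\<And>j. j \<in> {1..<N} \<Longrightarrow> b \<notin> ext_field j" by blast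
  have "b ^ (q ^ j) \<noteq> b" if "0 < j" "j < N" for j
    using b(2)[of j] that by (simp add: ext_field_def)
  then show ?thesis using b(1) unfolding generator_def by blast
qed

text \<open>Raising to the power \<open>q ^ i\<close> is injective, so a coincidence of conjugates
  would already give \<open>b = b ^ (q ^ (j - i))\<close>.\<close>

lemma generator_conjugates:
  assumes "generator N b" "i < j" "j - i < N"
  shows "b ^ (q ^ i) \<noteq> b ^ (q ^ j)"
proof
  assume "b ^ (q ^ i) = b ^ (q ^ j)"
  also have "q ^ j = q ^ (j - i) * q ^ i"
    using assms(2) by (simp flip: power_add)
  also have "b ^ (q ^ (j - i) * q ^ i) = (b ^ (q ^ (j - i))) ^ (q ^ i)"
    by (rule power_mult)
  finally have "b = b ^ (q ^ (j - i))" by (simp add: power_q_eq_iff)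
  then show False using assms(1)[unfolded generator_def] assms(2,3)
    by (metis zero_less_diff)
qed

text \<open>The relation from \<open>special_points\<close> is written in powers of
  \<open>b ^ (q ^ k)\<close>, so this conjugate has to supply the basis in which columns are
  read.\<close>

lemma generator_power:
  assumes "generator N b"
  shows "generator N (b ^ (q ^ k))"
  unfolding generator_def
proof (intro conjI allI impI)
  show "b ^ (q ^ k) \<in> ext_field N" using assms by (simp add: generator_def ext_field_power)
  fix j assume "0 < j \<and> j < N"
  then show "(b ^ (q ^ k)) ^ (q ^ j) \<noteq> b ^ (q ^ k)"
    using generator_conjugates[OF assms, of k "k + j"] by (auto simp: power_add power_mult)
qed

text \<open>A relation is a polynomial of degree less than \<open>N\<close> over the base field that
  vanishes at \<open>b\<close>, hence at all \<open>N\<close> conjugates of \<open>b\<close>; so it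
  is zero.\<close>

lemma indep_powers:
  assumes "generator N b"
  shows "indep (\<lambda>r. b ^ r) N"
  unfolding indep_def
proof (intro allI impI)
  fix v :: "nat \<Rightarrow> 'a" and r
  assume *: "(\<Sum>r<N. to_ac (v r) * b ^ r) = 0" and r: "r < N"
  define p where "p = (\<Sum>r<N. Polynomial.monom (to_ac (v r)) r)"
  have "poly p (b ^ (q ^ j)) = (\<Sum>r<N. to_ac (v r) * b ^ r) ^ (q ^ j)" for j
    unfolding p_def power_q_sum
    by (simp add: poly_sum poly_monom power_mult_distrib power_q_to_ac mult.commute flip: power_mult)
  then have "poly p (b ^ (q ^ j)) = 0" for j using * q_gt_1 by simp
  then have sub: "(\<lambda>j. b ^ (q ^ j)) ` {..<N} \<subseteq> {x. poly p x = 0}" by auto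
  have "inj_on (\<lambda>j. b ^ (q ^ j)) {..<N}"
    by (rule linorder_inj_onI) (use generator_conjugates[OF assms] in auto)
  then have card: "card ((\<lambda>j. b ^ (q ^ j)) ` {..<N}) = N" by (simp add: card_image)
  have deg: "Polynomial.degree p < N"
    unfolding p_def using r by (intro degree_sum_less) (auto intro: le_less_trans[OF degree_monom_le])
  have "p = 0"
  proof (rule ccontr)
    assume "p \<noteq> 0"
    then show False
      using card_mono[OF poly_roots_finite[OF \<open>p \<noteq> 0\<close>] sub] card_poly_roots_bound[OF \<open>p \<noteq> 0\<close>] card deg
      by simp
  qed
  then have "poly.coeff p r = 0" by simp
  then show "v r = 0" using r by (simp add: p_def coeff_sum)
qed


section \<open>Evaluation points with a prescribed relation\<close>

lemma coeff_prod_linear_mem_ext_field: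
  assumes "finite T" "\<And>t. t \<in> T \<Longrightarrow> c t \<in> ext_field N"
  shows "poly.coeff (\<Prod>t\<in>T. [:- c t, 1:]) i \<in> ext_field N"
  using assms
proof (induction T arbitrary: i rule: finite_induct)
  case (insert t T)
  have "poly.coeff [:- c t, 1:] j \<in> ext_field N" for j
    using insert.prems by (cases j) (auto simp: coeff_pCons ext_field_uminus split: nat.split)
  then show ?case
    using insert by (auto simp del: mult_pCons_left simp: coeff_mult intro!: ext_field_sum ext_field_mult)
qed (auto simp: coeff_1 of_bool_def)

text \<open>
  The points are the coefficients of $Q = \prod_{t=1}^k (Y - b^{q^t})$. Raising the coefficients of
  $Q$ to the power $q^s$ gives a polynomial $Q_s$ with roots $b^{q^{s+1}}, \ldots, b^{q^{s+k}}$. All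
  $Q_s$ with $s < k$ vanish at $b^{q^k}$, which is the relation. Evaluating
  $\sum_{s \le k} a_s Q_s$ at $b^{q^{k+1}}, \ldots, b^{q^{2k+1}}$ gives a triangular system in the
  $a_s$, so linearized polynomials of $q$-degree at most $k$ take arbitrary values at the points,
  which are therefore independent.
\<close>

lemma special_points:
  assumes "k < N" "generator N b"
  shows "\<exists>g. indep g (Suc k) \<and> (\<forall>i<Suc k. g i \<in> ext_field N) \<and>
    (\<forall>a. (\<Sum>i\<le>k. (b ^ (q ^ k)) ^ (k - i) * lpoly k a (g i)) = 0)"
proof -
  define Q where "Q = (\<Prod>t\<in>{1..k}. [:- (b ^ (q ^ t)), 1:])"
  \<comment> \<open>The reversed order gives \<open>g i\<close> the factor
    \<open>z ^ (k - i)\<close> in \<open>poly Q z\<close>, as the upward shift by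
    \<open>k - i\<close> requires.\<close>
  define g where "g i = poly.coeff Q (k - i)" for i
  have degQ: "Polynomial.degree Q = k"
    unfolding Q_def by (subst Polynomial.degree_prod_eq_sum_degree) auto
  have bL: "b \<in> ext_field N" using assms(2) by (simp add: generator_def)
  have gL: "g i \<in> ext_field N" for i
    unfolding g_def Q_def using bL by (intro coeff_prod_linear_mem_ext_field ext_field_power) auto
  have Q_eval: "poly Q z = (\<Sum>i\<le>k. z ^ (k - i) * g i)" for z
    unfolding poly_altdef degQ g_def
    by (rule sum.reindex_bij_witness[of _ "\<lambda>i. k - i" "\<lambda>i. k - i"]) (auto simp: mult.commute)
  \<comment> \<open>Both sides are the value of the sum of the a_s Q_s at
    \<open>b ^ (q ^ u)\<close>: there Q_s is the q^s-th power of the value of \<open>Q\<close> at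
    \<open>b ^ (q ^ (u - s))\<close>. The bound \<open>K \<le> Suc u\<close> makes
    \<open>u - s\<close> exact.\<close>
  have key: "(\<Sum>i\<le>k. (b ^ (q ^ u)) ^ (k - i) * lpoly K a (g i)) =
      (\<Sum>s<K. a s * poly Q (b ^ (q ^ (u - s))) ^ (q ^ s))" if "K \<le> Suc u" for K u a
  proof -
    have "(\<Sum>i\<le>k. (b ^ (q ^ u)) ^ (k - i) * lpoly K a (g i)) =
        (\<Sum>s<K. \<Sum>i\<le>k. (b ^ (q ^ u)) ^ (k - i) * (a s * g i ^ (q ^ s)))"
      unfolding lpoly_def sum_distrib_left by (rule sum.swap)
    also have "\<dots> = (\<Sum>s<K. a s * poly Q (b ^ (q ^ (u - s))) ^ (q ^ s))"
    proof (rule sum.cong[OF refl])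
      fix s assume "s \<in> {..<K}"
      then have "q ^ u = q ^ (u - s) * q ^ s" using that by (simp flip: power_add)
      then have "(b ^ (q ^ u)) ^ (k - i) = ((b ^ (q ^ (u - s))) ^ (k - i)) ^ (q ^ s)" for i
        by (simp add: mult_ac flip: power_mult)
      then show "(\<Sum>i\<le>k. (b ^ (q ^ u)) ^ (k - i) * (a s * g i ^ (q ^ s))) =
          a s * poly Q (b ^ (q ^ (u - s))) ^ (q ^ s)"
        by (simp only: Q_eval power_q_sum power_mult_distrib sum_distrib_left mult_ac)
    qed
    finally show ?thesis .
  qed
  have Q_zero: "poly Q (b ^ (q ^ t)) = 0" if "1 \<le> t" "t \<le> k" for t
    unfolding Q_def poly_prod using that by (intro prod_zero) auto
  have Q_nonzero: "poly Q (b ^ (q ^ Suc k)) \<noteq> 0"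
  proof
    assume "poly Q (b ^ (q ^ Suc k)) = 0"
    then obtain t where t: "t \<in> {1..k}" "b ^ (q ^ Suc k) = b ^ (q ^ t)"
      unfolding Q_def poly_prod by (auto simp del: power_Suc simp: prod_zero_iff)
    \<comment> \<open>The difference \<open>Suc k - t\<close> lies between 1 and \<open>k\<close>,
      hence below \<open>N\<close>.\<close>
    have "b ^ (q ^ t) \<noteq> b ^ (q ^ Suc k)"
      by (rule generator_conjugates[OF assms(2)]) (use t(1) assms(1) in auto)
    then show False using t(2)[symmetric] by contradiction
  qed
  \<comment> \<open>This is \<open>key\<close> with \<open>u = K = k\<close>: every exponent
    \<open>k - s\<close> with \<open>s < k\<close> lies in the range of
    \<open>Q_zero\<close>.\<close>
  have rel: "(\<Sum>i\<le>k. (b ^ (q ^ k)) ^ (k - i) * lpoly k a (g i)) = 0" for a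
    using q_gt_1 by (subst key) (auto intro!: sum.neutral simp: Q_zero)
  have ker: "a s = 0" if zero: "\<And>i. i < Suc k \<Longrightarrow> lpoly (Suc k) a (g i) = 0" and "s < Suc k" for a s
    using that(2)
  proof (induction s rule: less_induct)
    case (less j)
    \<comment> \<open>Evaluation at the conjugate of exponent \<open>Suc k + j\<close> isolates
      \<open>a j\<close>: terms with \<open>s < j\<close> vanish by induction, those with
      \<open>s > j\<close> because \<open>Suc k + j - s\<close> lies between 1 and
      \<open>k\<close>.\<close>
    have "0 = (\<Sum>i\<le>k. (b ^ (q ^ (Suc k + j))) ^ (k - i) * lpoly (Suc k) a (g i))"
      using zero by simp
    also have "\<dots> = (\<Sum>s<Suc k. a s * poly Q (b ^ (q ^ (Suc k + j - s))) ^ (q ^ s))"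
      by (rule key) simp
    also have "\<dots> = (\<Sum>s<Suc k. if s = j then a j * poly Q (b ^ (q ^ Suc k)) ^ (q ^ j) else 0)"
    proof (rule sum.cong[OF refl])
      fix s assume s: "s \<in> {..<Suc k}"
      consider "s < j" | "s = j" | "j < s" by linarith
      then show "a s * poly Q (b ^ (q ^ (Suc k + j - s))) ^ (q ^ s) =
          (if s = j then a j * poly Q (b ^ (q ^ Suc k)) ^ (q ^ j) else 0)"
      proof cases
        case 1
        then show ?thesis using less by simp
      next
        case 3
        then have "poly Q (b ^ (q ^ (Suc k + j - s))) = 0" using s by (intro Q_zero) auto
        then show ?thesis using 3 q_gt_1 by simp
      qed simp
    qed
    also have "\<dots> = a j * poly Q (b ^ (q ^ Suc k)) ^ (q ^ j)"
      using less.prems by simp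
    finally show ?case using Q_nonzero by simp
  qed
  have "indep g (Suc k)"
    unfolding indep_def
  proof (intro allI impI)
    fix v :: "nat \<Rightarrow> 'a" and j
    assume *: "(\<Sum>i<Suc k. to_ac (v i) * g i) = 0" and j: "j < Suc k"
    have "0 < N" using assms(1) by simp
    \<comment> \<open>A polynomial with value 1 at \<open>g j\<close> and 0 at the other points
      turns a relation among the points into \<open>v j = 0\<close>.\<close>
    then have "\<exists>a. (\<forall>s<Suc k. a s \<in> ext_field N) \<and>
        (\<forall>i<Suc k. lpoly (Suc k) a (g i) = (if i = j then 1 else 0))"
    proof (rule lpoly_interpolation)
      show "a s = 0" if "\<And>i. i < Suc k \<Longrightarrow> lpoly (Suc k) a (g i) = 0" "s < Suc k" for a s
        using that by (rule ker)
    qed (simp_all add: gL)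
    then obtain a where a: "\<And>i. i < Suc k \<Longrightarrow> lpoly (Suc k) a (g i) = (if i = j then 1 else 0)"
      by blast
    have "0 = lpoly (Suc k) a (\<Sum>i<Suc k. to_ac (v i) * g i)"
      unfolding * using q_gt_1 by (simp add: lpoly_def power_0_left)
    also have "\<dots> = (\<Sum>i<Suc k. to_ac (v i) * lpoly (Suc k) a (g i))"
      by (rule lpoly_comb)
    also have "\<dots> = (\<Sum>i<Suc k. if i = j then to_ac (v i) else 0)"
      by (rule sum.cong) (use a in auto)
    also have "\<dots> = to_ac (v j)" using j by simp
    finally show "v j = 0" by simp
  qed
  then show ?thesis using gL rel by blast
qed

section \<open>The code\<close>

definition initial_span :: "'a alg_closure \<Rightarrow> nat \<Rightarrow> 'a alg_closure set" where
  "initial_span b h = range (\<lambda>v :: nat \<Rightarrow> 'a. \<Sum>r<h. to_ac (v r) * b ^ r)"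

lemma initial_spanI: "x = (\<Sum>r<h. to_ac (v r :: 'a) * b ^ r) \<Longrightarrow> x \<in> initial_span b h"
  unfolding initial_span_def by blast

lemma initial_span_uminus: "x \<in> initial_span b h \<Longrightarrow> - x \<in> initial_span b h"
proof -
  assume "x \<in> initial_span b h"
  then obtain v :: "nat \<Rightarrow> 'a" where "x = (\<Sum>r<h. to_ac (v r) * b ^ r)"
    unfolding initial_span_def by blast
  then have "- x = (\<Sum>r<h. to_ac (- v r) * b ^ r)" by (simp add: sum_negf)
  then show "- x \<in> initial_span b h" by (rule initial_spanI)
qed

lemma initial_span_add:
  assumes "x \<in> initial_span b h" "y \<in> initial_span b h"
  shows "x + y \<in> initial_span b h"
proof -
  obtain v w where "x = (\<Sum>r<h. to_ac (v r :: 'a) * b ^ r)" "y = (\<Sum>r<h. to_ac (w r :: 'a) * b ^ r)"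
    using assms unfolding initial_span_def by blast
  then have "x + y = (\<Sum>r<h. to_ac (v r + w r) * b ^ r)"
    by (simp add: distrib_right sum.distrib)
  then show ?thesis by (rule initial_spanI)
qed

lemma initial_span_sum:
  "finite I \<Longrightarrow> (\<And>i. i \<in> I \<Longrightarrow> f i \<in> initial_span b h) \<Longrightarrow> sum f I \<in> initial_span b h"
proof (induction I rule: finite_induct)
  case empty
  have "0 = (\<Sum>r<h. to_ac (0 :: 'a) * b ^ r)" by simp
  then show ?case unfolding sum.empty by (rule initial_spanI)
qed (simp add: initial_span_add)

text \<open>Multiplication by \<open>b ^ d\<close> moves every coordinate up by \<open>d\<close>
  places. With \<open>d = k - i\<close> this is where the condition on the height of column
  \<open>k\<close> enters.\<close>

lemma initial_span_shift:
  assumes "x \<in> initial_span b h" "h + d \<le> h'"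
  shows "b ^ d * x \<in> initial_span b h'"
proof -
  obtain v where v: "x = (\<Sum>r<h. to_ac (v r :: 'a) * b ^ r)"
    using assms unfolding initial_span_def by blast
  define w where "w r = (if d \<le> r \<and> r < h + d then v (r - d) else 0)" for r
  have "(\<Sum>r<h'. to_ac (w r) * b ^ r) = (\<Sum>r\<in>{d..<h + d}. to_ac (v (r - d)) * b ^ r)"
    by (rule sum.mono_neutral_cong_right) (use assms(2) in \<open>auto simp: w_def\<close>)
  also have "\<dots> = (\<Sum>r<h. to_ac (v r) * b ^ (r + d))"
    by (rule sum.reindex_bij_witness[of _ "\<lambda>r. r + d" "\<lambda>r. r - d"]) auto
  also have "\<dots> = b ^ d * x"
    by (simp add: v power_add sum_distrib_left mult_ac)
  finally have "b ^ d * x = (\<Sum>r<h'. to_ac (w r) * b ^ r)" ..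
  then show ?thesis by (rule initial_spanI)
qed

lemma initial_span_full:
  assumes "0 < N" "generator N b"
  shows "initial_span b N = ext_field N"
proof -
  have bL: "b ^ r \<in> ext_field N" for r using assms(2) by (simp add: generator_def ext_field_power)
  show ?thesis
    unfolding initial_span_def
    using indep_spans[OF assms(1) indep_powers[OF assms(2)] bL] bL
    by (auto intro!: ext_field_sum ext_field_mult)
qed

lemma indep_mono: "indep g n \<Longrightarrow> l \<le> n \<Longrightarrow> indep g l"
  unfolding indep_def
proof (intro allI impI)
  fix v :: "nat \<Rightarrow> 'a" and j
  assume *: "\<forall>v :: nat \<Rightarrow> 'a. (\<Sum>j<n. to_ac (v j) * g j) = 0 \<longrightarrow> (\<forall>j<n. v j = 0)"
    and "l \<le> n" "(\<Sum>j<l. to_ac (v j) * g j) = 0" "j < l"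
  define w where "w i = (if i < l then v i else 0)" for i
  have "(\<Sum>j<n. to_ac (w j) * g j) = (\<Sum>j<l. to_ac (v j) * g j)"
    by (rule sum.mono_neutral_cong_right) (use \<open>l \<le> n\<close> in \<open>auto simp: w_def\<close>)
  then have "w j = 0" using * \<open>(\<Sum>j<l. to_ac (v j) * g j) = 0\<close> \<open>j < l\<close> \<open>l \<le> n\<close> by simp
  then show "v j = 0" using \<open>j < l\<close> by (simp add: w_def)
qed

end

text \<open>
  The heights \<open>h j\<close> will be $\min(\gamma_j, N)$; matrices have \<open>m\<close> rows, of which those from \<open>N\<close> on are zero.
\<close>

locale evaluation_code = finite_base_field ty q
  for ty :: "'a::{field,finite} itself" and q :: nat +
  fixes m n k N :: nat and h :: "nat \<Rightarrow> nat" and b :: "'a alg_closure" and g :: "nat \<Rightarrow> 'a alg_closure"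
  assumes k_pos: "0 < k" and k_less: "k < n" and N_pos: "0 < N" and N_le: "N \<le> m"
    and gen: "generator N b" and g_indep: "indep g n" and g_mem: "\<And>i. i < n \<Longrightarrow> g i \<in> ext_field N"
    and g_rel: "\<And>a. (\<Sum>i\<le>k. b ^ (k - i) * lpoly k a (g i)) = 0"
    and h_le: "\<And>j. j < n \<Longrightarrow> h j \<le> N"
    and h_full: "\<And>j. k < j \<Longrightarrow> j < n \<Longrightarrow> h j = N"
    and h_k: "h k = N \<or> (\<forall>i<k. h i + (k - i) \<le> h k)"
begin

section \<open>The evaluation code and its linearity\<close>

definition col_elt :: "'a mat \<Rightarrow> nat \<Rightarrow> 'a alg_closure" where
  "col_elt A j = (\<Sum>r<N. to_ac (A $$ (r, j)) * b ^ r)"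

text \<open>The coefficients \<open>a\<close> may lie anywhere in the algebraic closure, since the
  root bounds hold there; only the construction of codewords in \<open>code_exists\<close> chooses
  them in \<open>ext_field N\<close>.\<close>

definition code :: "'a mat set" where
  "code = {A \<in> carrier_mat m n. (\<forall>i<m. \<forall>j<n. h j \<le> i \<longrightarrow> A $$ (i, j) = 0) \<and>
     (\<exists>a. \<forall>j<n. col_elt A j = lpoly k a (g j))}"

lemma subspace_code: "VectorSpace.subspace class_ring code (module_mat TYPE('a) m n)"
proof -
  interpret matrix_vs m n "TYPE('a)" .
  have zero: "0\<^sub>m m n \<in> code"
  proof -
    have "\<forall>j<n. col_elt (0\<^sub>m m n) j = lpoly k (\<lambda>_. 0) (g j)"
      using N_le by (auto simp: col_elt_def lpoly_def)
    then show ?thesis unfolding code_def by auto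
  qed
  have add: "A + B \<in> code" if "A \<in> code" "B \<in> code" for A B
  proof -
    from that obtain u v where AB: "A \<in> carrier_mat m n" "B \<in> carrier_mat m n"
        "\<forall>i<m. \<forall>j<n. h j \<le> i \<longrightarrow> A $$ (i, j) = 0" "\<forall>i<m. \<forall>j<n. h j \<le> i \<longrightarrow> B $$ (i, j) = 0"
      and u: "\<And>j. j < n \<Longrightarrow> col_elt A j = lpoly k u (g j)"
      and v: "\<And>j. j < n \<Longrightarrow> col_elt B j = lpoly k v (g j)" unfolding code_def by blast
    have "col_elt (A + B) j = lpoly k (\<lambda>s. u s + v s) (g j)" if "j < n" for j
    proof -
      have "col_elt (A + B) j = col_elt A j + col_elt B j"
        unfolding col_elt_def sum.distrib[symmetric]
        by (rule sum.cong) (use AB that N_le in \<open>auto simp: distrib_right\<close>)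
      then show ?thesis using u[OF that] v[OF that] by (simp add: lpoly_def distrib_right sum.distrib)
    qed
    then show ?thesis using AB unfolding code_def by auto
  qed
  have smult: "c \<cdot>\<^sub>m A \<in> code" if "A \<in> code" for A c
  proof -
    from that obtain u where A: "A \<in> carrier_mat m n" "\<forall>i<m. \<forall>j<n. h j \<le> i \<longrightarrow> A $$ (i, j) = 0"
      and u: "\<And>j. j < n \<Longrightarrow> col_elt A j = lpoly k u (g j)" unfolding code_def by blast
    have "col_elt (c \<cdot>\<^sub>m A) j = lpoly k (\<lambda>s. to_ac c * u s) (g j)" if "j < n" for j
    proof -
      have "col_elt (c \<cdot>\<^sub>m A) j = to_ac c * col_elt A j"
        unfolding col_elt_def sum_distrib_left
        by (rule sum.cong) (use A that N_le in auto)
      then show ?thesis using u[OF that] by (simp add: lpoly_def sum_distrib_left mult.assoc)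
    qed
    then show ?thesis using A unfolding code_def by auto
  qed
  have sub: "code \<subseteq> carrier_mat m n" unfolding code_def by blast
  show ?thesis
  proof (rule VectorSpace.subspace.intro)
    show "vectorspace class_ring (module_mat TYPE('a) m n)" by (rule matrix_vs)
    show "LinearCombinations.submodule class_ring code (module_mat TYPE('a) m n)"
      unfolding LinearCombinations.submodule_def matrix_vs_simps
      using zero add smult sub vectorspace.axioms(1)[OF matrix_vs[where ?'a = 'a, of m n]] by blast
  qed
qed

text \<open>The powers of \<open>b\<close> are independent, and the entries from row
  \<open>h j\<close> on vanish in both matrices.\<close>

lemma col_elt_eq_iff:
  assumes "A \<in> code" "B \<in> code" "j < n"
  shows "col_elt A j = col_elt B j \<longleftrightarrow> (\<forall>r<h j. A $$ (r, j) = B $$ (r, j))"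
proof
  assume *: "\<forall>r<h j. A $$ (r, j) = B $$ (r, j)"
  have "A $$ (r, j) = B $$ (r, j)" if "r < N" for r
    using assms * that N_le by (cases "r < h j") (auto simp: code_def)
  then show "col_elt A j = col_elt B j" by (simp add: col_elt_def)
next
  assume "col_elt A j = col_elt B j"
  then have "(\<Sum>r<N. to_ac (A $$ (r, j)) * b ^ r) = (\<Sum>r<N. to_ac (B $$ (r, j)) * b ^ r)"
    by (simp add: col_elt_def)
  note eq = indepD[OF indep_powers[OF gen] this]
  then show "\<forall>r<h j. A $$ (r, j) = B $$ (r, j)" using eq h_le[OF assms(3)] by simp
qed

lemma code_eqI:
  assumes "A \<in> code" "B \<in> code" "\<And>j. j < n \<Longrightarrow> col_elt A j = col_elt B j"
  shows "A = B"
proof (rule eq_matI)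
  fix i j assume "i < dim_row B" "j < dim_col B"
  then have ij: "i < m" "j < n" using assms(2) by (auto simp: code_def)
  show "A $$ (i, j) = B $$ (i, j)"
  proof (cases "i < h j")
    case True
    then show ?thesis using col_elt_eq_iff[OF assms(1,2) ij(2)] assms(3)[OF ij(2)] by simp
  next
    case False
    then show ?thesis using assms(1,2) ij by (simp add: code_def)
  qed
qed (use assms in \<open>auto simp: code_def\<close>)

section \<open>Encoding by the first k columns and the dimension\<close>

lemma g_indep_k: "indep g k"
  using indep_mono[OF g_indep] k_less by simp

text \<open>The first \<open>k\<close> columns are the values at \<open>k\<close> independent
  points, and these determine the linearized polynomial.\<close>

lemma code_eqI_first_columns:
  assumes A: "A \<in> code" and B: "B \<in> code"
    and eq: "\<And>j r. j < k \<Longrightarrow> r < h j \<Longrightarrow> A $$ (r, j) = B $$ (r, j)"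
  shows "A = B"
proof -
  obtain u v where u: "\<And>j. j < n \<Longrightarrow> col_elt A j = lpoly k u (g j)"
    and v: "\<And>j. j < n \<Longrightarrow> col_elt B j = lpoly k v (g j)" using A B unfolding code_def by blast
  have "lpoly k (\<lambda>s. u s - v s) (g j) = 0" if "j < k" for j
  proof -
    have "j < n" using that k_less by simp
    then show ?thesis
      using eq[OF that] col_elt_eq_iff[OF A B, of j] u[of j] v[of j] by (simp add: lpoly_diff)
  qed
  then have uv: "u s = v s" if "s < k" for s
    using lpoly_zero_on_indep[OF g_indep_k, of "\<lambda>s. u s - v s"] that by force
  have "lpoly k u x = lpoly k v x" for x using uv by (rule lpoly_cong)
  then show ?thesis using code_eqI[OF A B] u v by simp
qed

text \<open>If \<open>h j = N\<close>, membership says no more than that the value lies in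
  \<open>ext_field N\<close>. For a shorter column \<open>k\<close>, \<open>g_rel\<close> writes the
  value as minus a sum of terms \<open>b ^ (k - i) * lpoly k a (g i)\<close>, each of which is
  shifted into the first \<open>h k\<close> coordinates.\<close>

lemma lpoly_g_mem_initial_span:
  assumes aL: "\<And>s. s < k \<Longrightarrow> a s \<in> ext_field N"
    and span: "\<And>i. i < k \<Longrightarrow> lpoly k a (g i) \<in> initial_span b (h i)" and "j < n"
  shows "lpoly k a (g j) \<in> initial_span b (h j)"
proof -
  have full: "lpoly k a (g j) \<in> initial_span b N"
    unfolding initial_span_full[OF N_pos gen] using aL g_mem[OF \<open>j < n\<close>] by (rule lpoly_mem_ext_field)
  consider "j < k" | "h j = N" | "j = k" "\<forall>i<k. h i + (k - i) \<le> h k"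
    using h_full[of j] h_k \<open>j < n\<close> by (metis nat_neq_iff)
  then show ?thesis
  proof cases
    case 3
    have "(\<Sum>i<k. b ^ (k - i) * lpoly k a (g i)) + lpoly k a (g k) = 0"
      using g_rel[of a] by (simp add: lessThan_Suc_atMost[symmetric])
    then have "lpoly k a (g k) = - (\<Sum>i<k. b ^ (k - i) * lpoly k a (g i))"
      by (simp add: eq_neg_iff_add_eq_0 add.commute)
    moreover have "(\<Sum>i<k. b ^ (k - i) * lpoly k a (g i)) \<in> initial_span b (h k)"
    proof (rule initial_span_sum)
      fix i assume i: "i \<in> {..<k}"
      then have "h i + (k - i) \<le> h k" using 3(2) by simp
      then show "b ^ (k - i) * lpoly k a (g i) \<in> initial_span b (h k)"
        using i by (intro initial_span_shift[OF span]) auto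
    qed simp
    ultimately show ?thesis using 3 initial_span_uminus by simp
  qed (use span full in auto)
qed

text \<open>Interpolation at the first \<open>k\<close> points realizes any entries in the first
  \<open>k\<close> columns, and the other columns then fit their heights automatically.\<close>

lemma code_exists:
  fixes x :: "nat \<Rightarrow> nat \<Rightarrow> 'a"
  shows "\<exists>A\<in>code. \<forall>j<k. \<forall>r<h j. A $$ (r, j) = x j r"
proof -
  let ?c = "\<lambda>j. \<Sum>r<h j. to_ac (x j r) * b ^ r"
  have c_span: "?c j \<in> initial_span b (h j)" for j
    by (rule initial_spanI) (rule refl)
  have bL: "b ^ r \<in> ext_field N" for r using gen by (simp add: generator_def ext_field_power)
  have c_L: "?c j \<in> ext_field N" for j using bL by (auto intro!: ext_field_sum ext_field_mult)
  have "\<exists>a. (\<forall>s<k. a s \<in> ext_field N) \<and> (\<forall>i<k. lpoly k a (g i) = ?c i)"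
  proof (rule lpoly_interpolation[OF N_pos])
    show "a s = 0" if "\<And>i. i < k \<Longrightarrow> lpoly k a (g i) = 0" "s < k" for a s
      using lpoly_zero_on_indep[OF g_indep_k] that by blast
  qed (use g_mem k_less c_L in simp_all)
  then obtain a where aL: "\<And>s. s < k \<Longrightarrow> a s \<in> ext_field N" and a: "\<And>i. i < k \<Longrightarrow> lpoly k a (g i) = ?c i"
    by blast
  \<comment> \<open>For \<open>j < k\<close> the coordinates are taken to be \<open>x j\<close>
    itself, so the matrix built from them has literally the prescribed entries.\<close>
  have "\<exists>w. lpoly k a (g j) = (\<Sum>r<h j. to_ac (w r) * b ^ r) \<and> (j < k \<longrightarrow> w = x j)" if "j < n" for j
  proof (cases "j < k")
    case True
    then show ?thesis using a by (intro exI[of _ "x j"]) simp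
  next
    case False
    have "lpoly k a (g j) \<in> initial_span b (h j)"
      by (rule lpoly_g_mem_initial_span[OF aL _ that]) (simp_all add: a c_span)
    then show ?thesis using False unfolding initial_span_def by blast
  qed
  then obtain w where w: "\<And>j. j < n \<Longrightarrow> lpoly k a (g j) = (\<Sum>r<h j. to_ac (w j r) * b ^ r)"
    and wx: "\<And>j. j < n \<Longrightarrow> j < k \<Longrightarrow> w j = x j" by metis
  define A where "A = mat m n (\<lambda>(r, j). if r < h j then w j r else 0)"
  have "col_elt A j = lpoly k a (g j)" if "j < n" for j
  proof -
    have "col_elt A j = (\<Sum>r<h j. to_ac (w j r) * b ^ r)"
      unfolding col_elt_def
      by (rule sum.mono_neutral_cong_right) (use that h_le[OF that] N_le in \<open>auto simp: A_def\<close>)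
    then show ?thesis using w[OF that] by simp
  qed
  then have "A \<in> code" unfolding code_def by (auto simp: A_def)
  moreover have "A $$ (r, j) = x j r" if "j < k" "r < h j" for j r
  proof -
    have "j < n" "r < m" using that k_less N_le h_le[of j] by auto
    then show ?thesis using that wx[of j] by (simp add: A_def)
  qed
  ultimately show ?thesis by blast
qed

text \<open>Restriction to the cells of the first \<open>k\<close> columns within the heights is a
  bijection: injective by \<open>code_eqI_first_columns\<close>, surjective by
  \<open>code_exists\<close>.\<close>

lemma card_code: "card code = q ^ (\<Sum>j<k. h j)"
proof -
  let ?I = "SIGMA j:{..<k}. {..<h j}"
  let ?T = "\<lambda>A. restrict (\<lambda>(j, r). A $$ (r, j)) ?I"
  have "bij_betw ?T code (?I \<rightarrow>\<^sub>E (UNIV :: 'a set))"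
    unfolding bij_betw_def
  proof
    show "inj_on ?T code"
    proof (rule inj_onI)
      fix A B assume AB: "A \<in> code" "B \<in> code" "?T A = ?T B"
      show "A = B"
      proof (rule code_eqI_first_columns[OF AB(1,2)])
        fix j r assume "j < k" "r < h j"
        then show "A $$ (r, j) = B $$ (r, j)" using fun_cong[OF AB(3), of "(j, r)"] by simp
      qed
    qed
    show "?T ` code = ?I \<rightarrow>\<^sub>E (UNIV :: 'a set)"
    proof (intro equalityI subsetI)
      fix y :: "nat \<times> nat \<Rightarrow> 'a" assume y: "y \<in> ?I \<rightarrow>\<^sub>E UNIV"
      obtain A where A: "A \<in> code" "\<forall>j<k. \<forall>r<h j. A $$ (r, j) = y (j, r)"
        using code_exists[of "\<lambda>j r. y (j, r)"] by blast
      have "y = ?T A"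
        by (rule PiE_ext[OF y]) (use A(2) in \<open>auto simp del: restrict_apply simp: restrict_apply'\<close>)
      then show "y \<in> ?T ` code" using A(1) by (rule image_eqI)
    next
      fix y assume "y \<in> ?T ` code"
      then show "y \<in> ?I \<rightarrow>\<^sub>E (UNIV :: 'a set)"
        by (elim imageE) (simp only: restrict_PiE_iff, simp)
    qed
  qed
  then have "card code = card (?I \<rightarrow>\<^sub>E (UNIV :: 'a set))" by (rule bij_betw_same_card)
  also have "\<dots> = q ^ card ?I" by (subst card_PiE) (simp_all add: card_UNIV)
  also have "card ?I = (\<Sum>j<k. h j)" by simp
  finally show ?thesis .
qed

lemma dim_code:
  "vectorspace.dim class_ring ((module_mat TYPE('a) m n)\<lparr>carrier := code\<rparr>) = (\<Sum>j<k. h j)"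
proof -
  interpret S: vectorspace class_ring "(module_mat TYPE('a) m n)\<lparr>carrier := code\<rparr>"
    by (rule vectorspace.subspace_is_vs[OF matrix_vs subspace_code])
  have "0 < card code" using q_gt_1 by (simp add: card_code)
  then have "finite code" by (rule card_ge_0_finite)
  then have "card code = card (carrier (class_ring :: 'a ring)) ^ S.dim"
    using S.card_carrier_eq_power_dim by simp
  also have "carrier (class_ring :: 'a ring) = UNIV" by (simp add: class_ring_simps)
  finally show ?thesis using q_gt_1 by (simp add: card_code card_UNIV)
qed

section \<open>Minimum rank distance\<close>

text \<open>The q^n coefficient vectors are split by the value of the polynomial at the
  corresponding combination of points. Each fibre has at most q^(k-1) elements and there are at most
  as many values as elements of the column space, so q^n is at most q^(rank + k - 1).\<close>

lemma rank_code_ge: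
  assumes A: "A \<in> code" and nz: "A \<noteq> 0\<^sub>m m n"
  shows "n + 1 \<le> vec_space.rank m A + k"
proof -
  obtain a where a: "\<And>j. j < n \<Longrightarrow> col_elt A j = lpoly k a (g j)" using A unfolding code_def by blast
  have Ac: "A \<in> carrier_mat m n" using A by (simp add: code_def)
  have "\<exists>s<k. a s \<noteq> 0"
  proof (rule ccontr)
    assume "\<not> (\<exists>s<k. a s \<noteq> 0)"
    then have "col_elt A j = 0" if "j < n" for j using a[OF that] by (simp add: lpoly_coeff_zero)
    moreover have "0\<^sub>m m n \<in> code"
      using subspace_code unfolding VectorSpace.subspace_def LinearCombinations.submodule_def
      by (simp add: matrix_vs_simps)
    moreover have "col_elt (0\<^sub>m m n) j = 0" if "j < n" for j
      using that N_le by (simp add: col_elt_def)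
    ultimately have "A = 0\<^sub>m m n" using A by (intro code_eqI) auto
    then show False using nz by contradiction
  qed
  then obtain s where s: "s < k" "a s \<noteq> 0" by blast
  let ?S = "{..<n} \<rightarrow>\<^sub>E (UNIV :: 'a set)"
  let ?u = "\<lambda>x. \<Sum>j<n. to_ac (x j) * g j"
  let ?T = "\<lambda>x. lpoly k a (?u x)"
  let ?R = "(\<lambda>x. A *\<^sub>v x) ` carrier_vec n"
  \<comment> \<open>By linearity, the value at the combination with coefficients \<open>x\<close> is
    the product of \<open>A\<close> with \<open>x\<close>, read in powers of
    \<open>b\<close>.\<close>
  have T_eq: "?T x = (\<Sum>r<N. to_ac ((A *\<^sub>v vec n x) $ r) * b ^ r)" for x
  proof -
    have "?T x = (\<Sum>j<n. to_ac (x j) * col_elt A j)"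
      by (simp add: lpoly_comb a)
    also have "\<dots> = (\<Sum>r<N. \<Sum>j<n. to_ac (x j) * (to_ac (A $$ (r, j)) * b ^ r))"
      unfolding col_elt_def sum_distrib_left by (rule sum.swap)
    also have "\<dots> = (\<Sum>r<N. to_ac ((A *\<^sub>v vec n x) $ r) * b ^ r)"
    proof (rule sum.cong[OF refl])
      fix r assume "r \<in> {..<N}"
      then have "(A *\<^sub>v vec n x) $ r = (\<Sum>j<n. A $$ (r, j) * x j)"
        using Ac N_le by (auto simp: scalar_prod_def lessThan_atLeast0 intro!: sum.cong)
      then show "(\<Sum>j<n. to_ac (x j) * (to_ac (A $$ (r, j)) * b ^ r)) = to_ac ((A *\<^sub>v vec n x) $ r) * b ^ r"
        by (simp add: to_ac_sum sum_distrib_left sum_distrib_right mult_ac)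
    qed
    finally show ?thesis .
  qed
  have fibre: "card {x \<in> ?S. ?T x = y} \<le> q ^ (k - 1)" for y
  proof -
    note fib = lpoly_fibre[where a = a and y = y, OF s]
    have "card {x \<in> ?S. ?T x = y} = card (?u ` {x \<in> ?S. ?T x = y})"
      by (rule card_image[symmetric], rule inj_on_subset[OF indep_inj_on[OF g_indep]]) blast
    also have "\<dots> \<le> card {x. lpoly k a x = y}" by (rule card_mono[OF fib(1)]) blast
    finally show ?thesis using fib(2) by linarith
  qed
  have finS: "finite ?S" by (simp add: finite_PiE)
  have "?T ` ?S \<subseteq> (\<lambda>v. \<Sum>r<N. to_ac (v $ r) * b ^ r) ` ?R"
  proof (rule image_subsetI)
    fix x :: "nat \<Rightarrow> 'a"
    have "A *\<^sub>v vec n x \<in> ?R" by (rule imageI) simp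
    then show "?T x \<in> (\<lambda>v. \<Sum>r<N. to_ac (v $ r) * b ^ r) ` ?R" unfolding T_eq by (rule imageI)
  qed
  then have "card (?T ` ?S) \<le> card ?R"
    using finite_carrier_vec by (intro surj_card_le) auto
  also have "\<dots> = q ^ vec_space.rank m A" by (simp add: card_col_space[OF Ac] card_UNIV)
  finally have cT: "card (?T ` ?S) \<le> q ^ vec_space.rank m A" .
  have "q ^ n = card ?S" by (simp add: card_funs)
  also have "?S = (\<Union>y\<in>?T ` ?S. {x \<in> ?S. ?T x = y})" by blast
  also have "card \<dots> \<le> (\<Sum>y\<in>?T ` ?S. card {x \<in> ?S. ?T x = y})"
    by (rule card_UN_le) (simp add: finS)
  also have "\<dots> \<le> card (?T ` ?S) * q ^ (k - 1)"
    using sum_bounded_above[of "?T ` ?S" "\<lambda>y. card {x \<in> ?S. ?T x = y}" "q ^ (k - 1)"] fibre by simp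
  also have "\<dots> \<le> q ^ vec_space.rank m A * q ^ (k - 1)" using cT by simp
  also have "\<dots> = q ^ (vec_space.rank m A + (k - 1))" by (simp add: power_add)
  finally have "n \<le> vec_space.rank m A + (k - 1)" using q_gt_1 by simp
  then show ?thesis using k_pos by simp
qed

text \<open>The lower bound is attained by a codeword whose first \<open>k - 1\<close> columns
  vanish, which leaves \<open>n - k + 1\<close> columns. Ones in the top \<open>h (k - 1)\<close>
  cells of column \<open>k - 1\<close> make it nonzero.\<close>

lemma min_rank_distance_code:
  assumes "0 < h (k - 1)"
  shows "has_min_rank_distance m n code (n - k + 1)"
proof -
  obtain A where A: "A \<in> code" "\<forall>j<k. \<forall>r<h j. A $$ (r, j) = (if j = k - 1 then 1 else 0)"
    using code_exists[of "\<lambda>j r. if j = k - 1 then 1 else 0"] by blast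
  have Ac: "A \<in> carrier_mat m n" using A(1) by (simp add: code_def)
  have "A $$ (0, k - 1) = 1" using A(2) assms k_pos by simp
  moreover have "0 < m" "k - 1 < n" using N_pos N_le k_less by auto
  ultimately have nz: "A \<noteq> 0\<^sub>m m n" by auto
  have "vec_space.rank m A \<le> n - (k - 1)"
  proof (rule vec_space_rank_le[OF Ac])
    fix i j assume ij: "i < m" "j < n" "j < k - 1"
    show "A $$ (i, j) = 0"
    proof (cases "i < h j")
      case True
      then show ?thesis using A(2) ij by simp
    next
      case False
      then show ?thesis using A(1) ij by (simp add: code_def)
    qed
  qed
  then have "vec_space.rank m A = n - k + 1"
    using rank_code_ge[OF A(1) nz] k_pos k_less by simp
  moreover have "n - k + 1 \<le> vec_space.rank m B" if "B \<in> code" "B \<noteq> 0\<^sub>m m n" for B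
    using rank_code_ge[OF that] k_less by simp
  ultimately show ?thesis using A(1) nz unfolding has_min_rank_distance_def by blast
qed

end

section \<open>Optimality\<close>

text \<open>Counted by columns: column \<open>c\<close> keeps \<open>\<gamma> c - i\<close> dots,
  and truncation to 0 is right for columns with at most \<open>i\<close> dots. The number of columns
  is \<open>k + i\<close> when \<open>k = n - \<delta> + 1\<close>.\<close>

lemma dots_outside_eq_sum:
  assumes "i < \<delta>" "\<delta> \<le> n"
  shows "dots_outside n {(r, c). c < n \<and> r < \<gamma> c} \<delta> i = (\<Sum>c<n - \<delta> + 1 + i. \<gamma> c - i)"
proof -
  have "{(r, c) \<in> {(r, c). c < n \<and> r < \<gamma> c}. i \<le> r \<and> c + (\<delta> - 1 - i) < n} =
      prod.swap ` (SIGMA c:{..<n - \<delta> + 1 + i}. {i..<\<gamma> c})" (is "?D = _ ` ?S")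
  proof (rule Set.set_eqI)
    fix x :: "nat \<times> nat"
    obtain r c where x: "x = (r, c)" by (cases x)
    have "c < n \<and> c + (\<delta> - 1 - i) < n \<longleftrightarrow> c < n - \<delta> + 1 + i" using assms by linarith
    then have "x \<in> ?D \<longleftrightarrow> prod.swap x \<in> ?S" unfolding x by auto
    also have "\<dots> \<longleftrightarrow> x \<in> prod.swap ` ?S"
      using inj_image_mem_iff[OF inj_swap, of "prod.swap x" ?S] by (simp only: swap_swap)
    finally show "x \<in> ?D \<longleftrightarrow> x \<in> prod.swap ` ?S" .
  qed
  then have "dots_outside n {(r, c). c < n \<and> r < \<gamma> c} \<delta> i = card ?S"
    unfolding dots_outside_def by (simp only: card_image[OF inj_swap])
  then show ?thesis by simp
qed

text \<open>
  Removing $i$ dots from each of the first $k$ columns costs at most $i - 1$ dots per column, plus one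
  for each column with at least $i$ dots. The columns after column $k$ pay for the former, and the
  dots left in column $k$ pay for the latter.
\<close>

lemma sum_columns_le:
  fixes \<gamma> :: "nat \<Rightarrow> nat"
  assumes "k + i \<le> n"
    and cond: "n \<le> \<gamma> k \<or> (\<forall>c<k. \<gamma> c + (k - c) \<le> \<gamma> k)"
    and full: "\<And>c. k < c \<Longrightarrow> c < n \<Longrightarrow> n \<le> \<gamma> c"
  shows "(\<Sum>c<k. \<gamma> c) \<le> (\<Sum>c<k + i. \<gamma> c - i)"
proof (cases i)
  case (Suc l)
  \<comment> \<open>If \<open>\<gamma> k\<close> is at least \<open>n\<close>, then
    \<open>\<gamma> k - i\<close> is at least \<open>k\<close>. Otherwise a column \<open>c\<close>
    with at least \<open>i\<close> dots satisfies \<open>i + (k - c) \<le> \<gamma> k\<close>, so it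
    is among the last \<open>\<gamma> k - i\<close> of the first \<open>k\<close> columns.\<close>
  have few: "card {c\<in>{..<k}. i \<le> \<gamma> c} \<le> \<gamma> k - i"
  proof (cases "n \<le> \<gamma> k")
    case True
    have "card {c\<in>{..<k}. i \<le> \<gamma> c} \<le> card {..<k}" by (rule card_mono) auto
    then show ?thesis using True assms(1) by simp
  next
    case False
    have "{c\<in>{..<k}. i \<le> \<gamma> c} \<subseteq> {k - (\<gamma> k - i)..<k}"
      using cond False by fastforce
    then have "card {c\<in>{..<k}. i \<le> \<gamma> c} \<le> card {k - (\<gamma> k - i)..<k}" by (rule card_mono[rotated]) simp
    then show ?thesis by simp
  qed
  \<comment> \<open>Here \<open>l = i - 1\<close>: a column with fewer than \<open>i\<close> dots
    loses at most \<open>l\<close>, any other column exactly \<open>l + 1\<close>.\<close>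
  have "(\<Sum>c<k. \<gamma> c) \<le> (\<Sum>c<k. (\<gamma> c - i) + l + of_bool (i \<le> \<gamma> c))"
    by (rule sum_mono) (auto simp: Suc)
  also have "\<dots> = (\<Sum>c<k. \<gamma> c - i) + l * k + card {c\<in>{..<k}. i \<le> \<gamma> c}"
    by (simp add: sum.distrib Int_def)
  also have "\<dots> \<le> (\<Sum>c<k. \<gamma> c - i) + l * k + (\<gamma> k - i)" using few by simp
  \<comment> \<open>There are \<open>l\<close> columns in this range, and each keeps at least
    \<open>n - i \<ge> k\<close> dots.\<close>
  also have "l * k \<le> (\<Sum>c\<in>{Suc k..<k + i}. \<gamma> c - i)"
  proof -
    have "k \<le> \<gamma> c - i" if "c \<in> {Suc k..<k + i}" for c
      using full[of c] that assms(1) by simp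
    then have "card {Suc k..<k + i} * k \<le> (\<Sum>c\<in>{Suc k..<k + i}. \<gamma> c - i)"
      using sum_bounded_below[of "{Suc k..<k + i}" k "\<lambda>c. \<gamma> c - i"] by simp
    then show ?thesis by (simp add: Suc)
  qed
  also have "(\<Sum>c<k. \<gamma> c - i) + (\<Sum>c\<in>{Suc k..<k + i}. \<gamma> c - i) + (\<gamma> k - i) = (\<Sum>c<k + i. \<gamma> c - i)"
  proof -
    have "(\<Sum>c<k + i. \<gamma> c - i) = (\<Sum>c\<in>{..<k} \<union> {k..<k + i}. \<gamma> c - i)"
      by (rule arg_cong[where f = "sum _"]) auto
    also have "\<dots> = (\<Sum>c<k. \<gamma> c - i) + (\<Sum>c\<in>{k..<k + i}. \<gamma> c - i)"
      by (rule sum.union_disjoint) auto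
    also have "(\<Sum>c\<in>{k..<k + i}. \<gamma> c - i) = (\<gamma> k - i) + (\<Sum>c\<in>{Suc k..<k + i}. \<gamma> c - i)"
      by (rule sum.atLeast_Suc_lessThan) (simp add: Suc)
    finally show ?thesis by simp
  qed
  finally show ?thesis by simp
qed simp

theorem theorem2p3:
  fixes m n \<delta> k q :: nat and F :: "(nat \<times> nat) set" and \<gamma> :: "nat \<Rightarrow> nat"
  assumes "2 \<le> \<delta>" and "\<delta> \<le> n" and "n \<le> m"
    and "k = n - \<delta> + 1"
    and "ferrers_diagram m n F"
    and "\<And>j. j < n \<Longrightarrow> \<gamma> j = col_dots F j"
    and "n \<le> \<gamma> k \<or> (\<forall>i<k. int (\<gamma> i) - int i \<le> int (\<gamma> k) - int k)"
    and "k + 1 < n \<Longrightarrow> n \<le> \<gamma> (k + 1)"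
    and "primepow q" and "card (UNIV :: 'a::{field,finite} set) = q"
  shows "\<exists>C :: 'a mat set. optimal_ferrers_code m n F (\<Sum>i<k. \<gamma> i) \<delta> C"
proof -
  have k: "0 < k" "k < n" "n - k + 1 = \<delta>" using assms(1,2,4) by auto
  obtain \<gamma>' where \<gamma>': "1 \<le> \<gamma>' 0" "\<And>i j. i \<le> j \<Longrightarrow> j < n \<Longrightarrow> \<gamma>' i \<le> \<gamma>' j" "\<gamma>' (n - 1) = m"
      "F = {(i, j). j < n \<and> i < \<gamma>' j}"
    using iffD1[OF ferrers_diagram_iff_columns assms(5)] k(2) by auto
  have eq: "\<gamma> j = \<gamma>' j" if "j < n" for j
  proof -
    have "{i. (i, j) \<in> F} = {..<\<gamma>' j}" using \<gamma>'(4) that by auto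
    then show ?thesis using assms(6)[OF that] by (simp add: col_dots_def)
  qed
  have mono: "\<gamma> i \<le> \<gamma> j" if "i \<le> j" "j < n" for i j using \<gamma>'(2)[OF that] eq that by simp
  have pos: "0 < \<gamma> j" if "j < n" for j using mono[of 0 j] \<gamma>'(1) eq[of 0] that k by simp
  have le_m: "\<gamma> j \<le> m" if "j < n" for j using mono[of j "n - 1"] \<gamma>'(3) eq[of "n - 1"] that by simp
  have F: "F = {(i, j). j < n \<and> i < \<gamma> j}" using \<gamma>'(4) eq by auto
  \<comment> \<open>The integer inequality is rearranged so that the only subtraction left,
    \<open>k - i\<close>, is exact.\<close>
  have cond: "n \<le> \<gamma> k \<or> (\<forall>i<k. \<gamma> i + (k - i) \<le> \<gamma> k)"
    using assms(7) by force
  have full: "n \<le> \<gamma> j" if "k < j" "j < n" for j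
    using assms(8) mono[of "k + 1" j] that by simp

  \<comment> \<open>At least \<open>n\<close>, so that \<open>ext_field N\<close> contains
    \<open>n\<close> independent points; at least \<open>\<gamma> (k - 1)\<close>, so that the first
    \<open>k\<close> columns keep all their dots. A column from \<open>k\<close> on with at least
    \<open>n\<close> dots still reaches height \<open>N\<close> by monotonicity.\<close>
  define N where "N = max n (\<gamma> (k - 1))"
  define h where "h j = min (\<gamma> j) N" for j
  have N_ge: "\<gamma> j \<le> N" if "j < k" for j
    using mono[of j "k - 1"] that k by (simp add: N_def le_max_iff_disj)
  have h_eq: "h j = \<gamma> j" if "j < k" for j using N_ge[OF that] by (simp add: h_def)
  have N_le_\<gamma>: "N \<le> \<gamma> j" if "k \<le> j" "j < n" "n \<le> \<gamma> j" for j
    using mono[of "k - 1" j] that by (simp add: N_def)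
  have h_k: "h k = N \<or> (\<forall>i<k. h i + (k - i) \<le> h k)"
  proof (cases "n \<le> \<gamma> k")
    case True
    then show ?thesis using N_le_\<gamma>[of k] k by (simp add: h_def)
  next
    case False
    then have "h k = \<gamma> k" by (simp add: h_def N_def)
    then show ?thesis using cond False h_eq by simp
  qed

  interpret finite_base_field "TYPE('a)" q
    by (rule finite_base_field.intro) (use assms(9,10) in auto)
  have "0 < N" "k < N" "n \<le> N" using k by (auto simp: N_def)
  obtain b0 where b0: "generator N b0" using generator_exists \<open>0 < N\<close> by blast
  define b where "b = b0 ^ (q ^ k)"
  have b: "generator N b" unfolding b_def by (rule generator_power[OF b0])
  obtain g0 where g0: "indep g0 (Suc k)" "\<And>i. i < Suc k \<Longrightarrow> g0 i \<in> ext_field N"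
      "\<And>a. (\<Sum>i\<le>k. b ^ (k - i) * lpoly k a (g0 i)) = 0"
    using special_points[OF \<open>k < N\<close> b0] unfolding b_def by blast
  \<comment> \<open>The relation involves only the first \<open>k + 1\<close> points. The others are
    arbitrary independent choices, for which \<open>n \<le> N\<close> leaves room.\<close>
  obtain g where g: "indep g n" "\<And>i. i < n \<Longrightarrow> g i \<in> ext_field N" "\<And>i. i < Suc k \<Longrightarrow> g i = g0 i"
    using indep_extend[OF _ \<open>n \<le> N\<close> g0(1,2)] k(2) by auto
  interpret evaluation_code "TYPE('a)" q m n k N h b g
  proof (unfold_locales)
    show "N \<le> m" using assms(3) le_m[of "k - 1"] k by (simp add: N_def)
    show "(\<Sum>i\<le>k. b ^ (k - i) * lpoly k a (g i)) = 0" for a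
      using g0(3)[of a] g(3) by simp
    show "h j = N" if "k < j" "j < n" for j
      using N_le_\<gamma>[of j] full[of j] that by (simp add: h_def)
  qed (use k \<open>0 < N\<close> b g h_k in \<open>auto simp: h_def\<close>)

  have dim: "(\<Sum>j<k. h j) = (\<Sum>j<k. \<gamma> j)" using h_eq by simp
  have "has_min_rank_distance m n code \<delta>"
    using min_rank_distance_code h_eq[of "k - 1"] pos[of "k - 1"] k by simp
  moreover have "A $$ (i, j) = 0" if "A \<in> code" "i < m" "j < n" "(i, j) \<notin> F" for A i j
    using that by (auto simp: F code_def h_def)
  ultimately have code: "ferrers_code m n F (\<Sum>i<k. \<gamma> i) \<delta> code"
    unfolding ferrers_code_def using subspace_code dim_code dim by auto

  have v: "dots_outside n F \<delta> i = (\<Sum>c<k + i. \<gamma> c - i)" if "i \<le> \<delta> - 1" for i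
    using dots_outside_eq_sum[of i \<delta> n \<gamma>] that F assms(1,2,4) by simp
  have "(\<Sum>i<k. \<gamma> i) = Min (dots_outside n F \<delta> ` {0..\<delta> - 1})"
  proof (rule Min_eqI[symmetric])
    show "(\<Sum>i<k. \<gamma> i) \<le> y" if "y \<in> dots_outside n F \<delta> ` {0..\<delta> - 1}" for y
    proof -
      from that obtain i where i: "i \<le> \<delta> - 1" "y = dots_outside n F \<delta> i" by auto
      have "k + i \<le> n" using i(1) k by simp
      from sum_columns_le[OF this cond full] show ?thesis using i v by simp
    qed
    \<comment> \<open>The minimum is attained at \<open>i = 0\<close>, where the first
      \<open>k\<close> columns are counted in full.\<close>
    show "(\<Sum>i<k. \<gamma> i) \<in> dots_outside n F \<delta> ` {0..\<delta> - 1}"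
      using v[of 0] by (intro image_eqI[of _ _ 0]) auto
  qed simp
  then show ?thesis using code unfolding optimal_ferrers_code_def by blast
qed

end
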